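(* Let $G=(V,E)$ be a finite compact metric graph with edge lengths $\ell=(\ell_e)_{e\in E}\in(0,\infty)^E$ and let $-\Delta_{G,\ell}$ be a self-adjoint metric-graph Laplacian with standard Kirchhoff conditions at interior vertices and fixed self-adjoint separated conditions at exterior vertices. Let $\omega\subset G$ be measurable and let $\alpha=(\alpha_e)_{e\in E}$ with $\alpha_e=|\omega\cap e|$. Then $$C_\infty(\omega;\ell)=\min_{q\in I(\ell)}\alpha\cdot q,$$ the minimum being attained. In particular, the high-frequency localization constant $C_\infty(\omega;\ell)$ depends on $\omega$ only through the edgewise measures $(|\omega\cap e|)_{e\in E}$.
   Context: $-\Delta_{G,\ell}$ acts as $-d^2/dx^2$ on each edge $e\cong[0,\ell_e]$; the standard Kirchhoff condition at a vertex means continuity and vanishing sum of outward derivatives. $|\cdot|$ is one-dimensional Lebesgue measure. **Localization constant.** $$C_\infty(\omega;\ell):=\lim_{\Lambda\to\infty}\ \inf\Big\{\int_\omega|u|^2:\ -\Delta_{G,\ell}u=\lambda u,\ \lambda\ge\Lambda,\ \|u\|_{L^2(G)}=1\Big\}$$ (the infimum is nondecreasing in $\Lambda$ and bounded, so the limit exists). **Homogenized intensity.** If $-\Delta_{G,\ell}u=k^2u$ with $k>0$, write $u_e(x)=A_e\cos(kx)+B_e\sin(kx)$, $A_e,B_e\in\mathbb C$, on each edge, and set $q_e(u)=\frac{|A_e|^2+|B_e|^2}{2}$, $q(u)=(q_e(u))_{e\in E}$. **Attainable set.** $I(\ell)\subset[0,\infty)^E$ is the set of all $q$ for which there exist exact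 eigenfunctions $u_n$ and frequencies $k_n\to\infty$ with $-\Delta_{G,\ell}u_n=k_n^2u_n$, $\|u_n\|_{L^2(G)}=1$ and $q(u_n)\to q$. *)

theory Defs
  imports "HOL-Analysis.Analysis" "Graph_Theory.Digraph"
begin

text \<open>
  A finite metric graph is a finite multigraph (loops and parallel edges allowed) together with an
  edge length function \<open>l\<close>. The arc \<open>e\<close> is identified with \<open>{0..l e}\<close>, where \<open>0\<close> is its tail and
  \<open>l e\<close> its head; the orientation only records this parametrization. A function on the graph is a
  family \<open>u\<close> with \<open>u e x\<close> its value at the point \<open>x \<in> {0..l e}\<close> of the edge \<open>e\<close>. Likewise
  \<open>\<omega> e \<subseteq> {0..l e}\<close> is the part on \<open>e\<close> of a subset \<open>\<omega>\<close> of the graph.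
\<close>

type_synonym 'e graph_fun = "'e \<Rightarrow> real \<Rightarrow> complex"
type_synonym 'e graph_set = "'e \<Rightarrow> real set"

text \<open>A loop contributes twice to the degree.\<close>

definition exterior_verts :: "('v, 'e) pre_digraph \<Rightarrow> 'v set" where
  "exterior_verts G = {v \<in> verts G. in_degree G v + out_degree G v = 1}"

definition interior_verts :: "('v, 'e) pre_digraph \<Rightarrow> 'v set" where
  "interior_verts G = verts G - exterior_verts G"

subsection \<open>Vertex conditions\<close>

definition edge_deriv :: "real \<Rightarrow> (real \<Rightarrow> complex) \<Rightarrow> real \<Rightarrow> complex" where
  "edge_deriv L f x = vector_derivative f (at x within {0..L})"

text \<open>Derivatives at a vertex are taken in the direction pointing from the vertex into the edge.\<close>

definition kirchhoff_condition ::
  "('v, 'e) pre_digraph \<Rightarrow> ('e \<Rightarrow> real) \<Rightarrow> 'e graph_fun \<Rightarrow> 'v \<Rightarrow> bool" where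
  "kirchhoff_condition G l u v \<longleftrightarrow>
     (\<exists>c. (\<forall>e\<in>out_arcs G v. u e 0 = c) \<and> (\<forall>e\<in>in_arcs G v. u e (l e) = c)) \<and>
     (\<Sum>e\<in>out_arcs G v. edge_deriv (l e) (u e) 0) +
     (\<Sum>e\<in>in_arcs G v. - edge_deriv (l e) (u e) (l e)) = 0"

text \<open>
  A condition at an exterior vertex \<open>v\<close> is the set of admissible Cauchy data
  \<open>(u(v), \<partial>u(v))\<close>. It is self-adjoint iff this set equals its orthogonal complement for the
  boundary form \<open>((a, b), (c, d)) \<mapsto> a * cnj d - b * cnj c\<close> from integration by parts.
  By \<open>selfadjoint_condition_iff\<close> below these are the Dirichlet, Neumann and real Robin conditions.
\<close>

definition selfadjoint_condition :: "(complex \<times> complex) set \<Rightarrow> bool" where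
  "selfadjoint_condition M \<longleftrightarrow> M = {(a, b). \<forall>(c, d)\<in>M. a * cnj d - b * cnj c = 0}"

definition exterior_condition ::
  "('v, 'e) pre_digraph \<Rightarrow> ('e \<Rightarrow> real) \<Rightarrow> (complex \<times> complex) set \<Rightarrow> 'e graph_fun \<Rightarrow> 'v \<Rightarrow> bool" where
  "exterior_condition G l M u v \<longleftrightarrow>
     (\<forall>e\<in>out_arcs G v. (u e 0, edge_deriv (l e) (u e) 0) \<in> M) \<and>
     (\<forall>e\<in>in_arcs G v. (u e (l e), - edge_deriv (l e) (u e) (l e)) \<in> M)"

subsection \<open>The Laplacian\<close>

text \<open>
  \<open>f\<close> is (the continuously differentiable representative of) an element of the Sobolev space
  \<open>H\<^sup>2(0, L)\<close> and its weak second derivative is \<open>g \<in> L\<^sup>2(0, L)\<close>, which is determined up to null sets.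
\<close>

definition H2_second_deriv :: "real \<Rightarrow> (real \<Rightarrow> complex) \<Rightarrow> (real \<Rightarrow> complex) \<Rightarrow> bool" where
  "H2_second_deriv L f g \<longleftrightarrow>
     (\<forall>x\<in>{0..L}. f differentiable (at x within {0..L})) \<and>
     set_borel_measurable lebesgue {0..L} g \<and>
     set_integrable lebesgue {0..L} (\<lambda>x. (cmod (g x))\<^sup>2) \<and>
     (\<forall>x\<in>{0..L}. edge_deriv L f x = edge_deriv L f 0 + (LINT t:{0..x}|lebesgue. g t))"

text \<open>\<open>neg_laplacian G l M u f\<close>: \<open>u\<close> is in the domain of the operator, which maps it to \<open>f\<close>.\<close>

definition neg_laplacian ::
  "('v, 'e) pre_digraph \<Rightarrow> ('e \<Rightarrow> real) \<Rightarrow> ('v \<Rightarrow> (complex \<times> complex) set) \<Rightarrow>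
   'e graph_fun \<Rightarrow> 'e graph_fun \<Rightarrow> bool" where
  "neg_laplacian G l M u f \<longleftrightarrow>
     (\<forall>e\<in>arcs G. H2_second_deriv (l e) (u e) (\<lambda>x. - f e x)) \<and>
     (\<forall>v\<in>interior_verts G. kirchhoff_condition G l u v) \<and>
     (\<forall>v\<in>exterior_verts G. exterior_condition G l (M v) u v)"

definition measurable_subset ::
  "('v, 'e) pre_digraph \<Rightarrow> ('e \<Rightarrow> real) \<Rightarrow> 'e graph_set \<Rightarrow> bool" where
  "measurable_subset G l \<omega> \<longleftrightarrow> (\<forall>e\<in>arcs G. \<omega> e \<in> sets lebesgue \<and> \<omega> e \<subseteq> {0..l e})"

definition L2_mass :: "('v, 'e) pre_digraph \<Rightarrow> 'e graph_set \<Rightarrow> 'e graph_fun \<Rightarrow> real" where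
  "L2_mass G \<omega> u = (\<Sum>e\<in>arcs G. LINT x:\<omega> e|lebesgue. (cmod (u e x))\<^sup>2)"

definition L2_norm :: "('v, 'e) pre_digraph \<Rightarrow> ('e \<Rightarrow> real) \<Rightarrow> 'e graph_fun \<Rightarrow> real" where
  "L2_norm G l u = sqrt (L2_mass G (\<lambda>e. {0..l e}) u)"

definition normalized_eigenfunction ::
  "('v, 'e) pre_digraph \<Rightarrow> ('e \<Rightarrow> real) \<Rightarrow> ('v \<Rightarrow> (complex \<times> complex) set) \<Rightarrow>
   real \<Rightarrow> 'e graph_fun \<Rightarrow> bool" where
  "normalized_eigenfunction G l M \<mu> u \<longleftrightarrow>
     neg_laplacian G l M u (\<lambda>e x. complex_of_real \<mu> * u e x) \<and> L2_norm G l u = 1"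

subsection \<open>Localization constant and attainable intensities\<close>

definition C_infty ::
  "('v, 'e) pre_digraph \<Rightarrow> ('e \<Rightarrow> real) \<Rightarrow> ('v \<Rightarrow> (complex \<times> complex) set) \<Rightarrow>
   'e graph_set \<Rightarrow> real" where
  "C_infty G l M \<omega> =
     Lim at_top (\<lambda>\<Lambda>::real. Inf {L2_mass G \<omega> u | u \<mu>. \<mu> \<ge> \<Lambda> \<and> normalized_eigenfunction G l M \<mu> u})"

text \<open>The amplitudes \<open>A\<close>, \<open>B\<close> on an edge of length \<open>L > 0\<close> are unique because \<open>k > 0\<close>.\<close>

definition edge_intensity :: "real \<Rightarrow> real \<Rightarrow> (real \<Rightarrow> complex) \<Rightarrow> real" where
  "edge_intensity L k f =
     (THE r. \<exists>A B. (\<forall>x\<in>{0..L}. f x = A * complex_of_real (cos (k * x)) + B * complex_of_real (sin (k * x)))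
                 \<and> r = ((cmod A)\<^sup>2 + (cmod B)\<^sup>2) / 2)"

definition attainable_set ::
  "('v, 'e) pre_digraph \<Rightarrow> ('e \<Rightarrow> real) \<Rightarrow> ('v \<Rightarrow> (complex \<times> complex) set) \<Rightarrow> ('e \<Rightarrow> real) set" where
  "attainable_set G l M =
     {q \<in> arcs G \<rightarrow>\<^sub>E {0..}.
        \<exists>(u :: nat \<Rightarrow> 'e graph_fun) (k :: nat \<Rightarrow> real).
          filterlim k at_top sequentially \<and>
          (\<forall>n. k n > 0 \<and> normalized_eigenfunction G l M ((k n)\<^sup>2) (u n)) \<and>
          (\<forall>e\<in>arcs G. (\<lambda>n. edge_intensity (l e) (k n) (u n e)) \<longlonglongrightarrow> q e)}"

definition edge_dot :: "('v, 'e) pre_digraph \<Rightarrow> ('e \<Rightarrow> real) \<Rightarrow> ('e \<Rightarrow> real) \<Rightarrow> real" where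
  "edge_dot G \<alpha> q = (\<Sum>e\<in>arcs G. \<alpha> e * q e)"

subsection \<open>Sanity checks\<close>

lemma selfadjoint_condition_robin:
  "selfadjoint_condition {(a, b). complex_of_real (cos t) * a + complex_of_real (sin t) * b = 0}"
  (is "selfadjoint_condition ?M")
proof -
  let ?c = "complex_of_real (cos t)" and ?s = "complex_of_real (sin t)"
  have cs: "?c * ?c + ?s * ?s = 1"
    by (metis of_real_1 of_real_add of_real_mult power2_eq_square sin_cos_squared_add2)
  have par: "a = - ?s * (?c * b - ?s * a) \<and> b = ?c * (?c * b - ?s * a)"
    if "?c * a + ?s * b = 0" for a b
  proof
    have "a = (?c * ?c + ?s * ?s) * a - ?c * (?c * a + ?s * b)" using cs that by simp
    then show "a = - ?s * (?c * b - ?s * a)" by (simp add: algebra_simps)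
    have "b = (?c * ?c + ?s * ?s) * b - ?s * (?c * a + ?s * b)" using cs that by simp
    then show "b = ?c * (?c * b - ?s * a)" by (simp add: algebra_simps)
  qed
  have 1: "a * cnj d - b * cnj c = 0"
    if ab: "?c * a + ?s * b = 0" and cd: "?c * c + ?s * d = 0" for a b c d
  proof -
    obtain z w where "a = - ?s * z" "b = ?c * z" "c = - ?s * w" "d = ?c * w"
      using par[OF ab] par[OF cd] by metis
    then show ?thesis by simp
  qed
  have 2: "?c * a + ?s * b = 0" if "\<forall>(c, d)\<in>?M. a * cnj d - b * cnj c = 0" for a b
  proof -
    have "(- ?s, ?c) \<in> ?M" by simp
    with that have "a * cnj ?c - b * cnj (- ?s) = 0" by blast
    then show ?thesis by (simp add: mult.commute)
  qed
  show ?thesis unfolding selfadjoint_condition_def using 1 2 by blast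
qed

lemma selfadjoint_condition_iff:
  "selfadjoint_condition M \<longleftrightarrow>
     (\<exists>t. M = {(a, b). complex_of_real (cos t) * a + complex_of_real (sin t) * b = 0})"
proof
  assume sa: "selfadjoint_condition M"
  then have M: "(a, b) \<in> M \<longleftrightarrow> (\<forall>(c, d)\<in>M. a * cnj d - b * cnj c = 0)" for a b
    unfolding selfadjoint_condition_def by blast
  have "\<exists>p\<in>M. p \<noteq> (0, 0)"
  proof (rule ccontr)
    assume "\<not> ?thesis"
    then have "\<forall>(c, d)\<in>M. 1 * cnj d - 0 * cnj c = 0" by auto
    then have "(1, 0) \<in> M" using M by blast
    with \<open>\<not> ?thesis\<close> show False by auto
  qed
  then obtain c d where cd: "(c, d) \<in> M" "(c, d) \<noteq> (0, 0)" by (metis surj_pair)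
  have real: "c * cnj d = d * cnj c" using M[of c d] cd by auto
  have ex: "\<exists>x y z. c = of_real x * z \<and> d = of_real y * z \<and> z \<noteq> 0 \<and> x\<^sup>2 + y\<^sup>2 = (1::real)"
  proof -
    show ?thesis
    proof (cases "c = 0")
      case True
      then show ?thesis using cd(2) by (intro exI[of _ 0] exI[of _ 1] exI[of _ d]) auto
    next
      case False
      define r where "r = Re (d / c)"
      have "d / c = cnj (d / c)" using real False by (simp add: field_simps)
      then have "d / c = of_real r" unfolding r_def
        by (metis Reals_cnj_iff of_real_Re)
      then have d: "d = of_real r * c" using False by (simp add: field_simps)
      define m where "m = sqrt (1 + r\<^sup>2)"
      have m: "m > 0" "m\<^sup>2 = 1 + r\<^sup>2" unfolding m_def
        by (auto simp: add_pos_nonneg add_nonneg_nonneg)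
      show ?thesis
      proof (intro exI conjI)
        show "c = of_real (1 / m) * (of_real m * c)" using m by simp
        show "d = of_real (r / m) * (of_real m * c)" using m d by simp
        show "of_real m * c \<noteq> 0" using m False by simp
        have "(1 / m)\<^sup>2 + (r / m)\<^sup>2 = (1 + r\<^sup>2) / m\<^sup>2"
          by (simp only: power_divide add_divide_distrib power_one)
        also have "\<dots> = m\<^sup>2 / m\<^sup>2" by (simp only: m(2))
        finally show "(1 / m)\<^sup>2 + (r / m)\<^sup>2 = 1" using m(1) by simp
      qed
    qed
  qed
  then obtain x y z where xyz: "c = of_real x * z" "d = of_real y * z" "z \<noteq> 0" "x\<^sup>2 + y\<^sup>2 = 1"
    by blast
  have "y\<^sup>2 + (- x)\<^sup>2 = 1" using xyz by simp
  then obtain t where t: "y = cos t" "- x = sin t" using sincos_total_2pi by metis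
  let ?R = "{(a, b). complex_of_real (cos t) * a + complex_of_real (sin t) * b = 0}"
  have R_iff: "(a, b) \<in> ?R \<longleftrightarrow> a * cnj d - b * cnj c = 0" for a b
  proof -
    have s: "complex_of_real (sin t) = - of_real x" using t by (metis of_real_minus)
    have "a * cnj d - b * cnj c =
        cnj z * (complex_of_real (cos t) * a + complex_of_real (sin t) * b)"
      unfolding s using xyz(1,2) t(1) by (simp add: algebra_simps)
    then show ?thesis using xyz(3) by simp
  qed
  have sub: "M \<subseteq> ?R"
  proof
    fix p assume p: "p \<in> M"
    obtain a b where ab: "p = (a, b)" by (metis surj_pair)
    have "a * cnj d - b * cnj c = 0" using M[of a b] p cd(1) unfolding ab by blast
    then show "p \<in> ?R" using R_iff unfolding ab by blast
  qed
  have "?R \<subseteq> M"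
  proof
    fix p assume p: "p \<in> ?R"
    obtain a b where ab: "p = (a, b)" by (metis surj_pair)
    have "\<forall>(c, d)\<in>?R. a * cnj d - b * cnj c = 0"
      using p selfadjoint_condition_robin[of t] unfolding ab selfadjoint_condition_def by blast
    then have "\<forall>(c, d)\<in>M. a * cnj d - b * cnj c = 0" using sub by blast
    then show "p \<in> M" using M unfolding ab by blast
  qed
  with sub show "\<exists>t. M = {(a, b). complex_of_real (cos t) * a + complex_of_real (sin t) * b = 0}"
    by blast
next
  assume "\<exists>t. M = {(a, b). complex_of_real (cos t) * a + complex_of_real (sin t) * b = 0}"
  then show "selfadjoint_condition M" using selfadjoint_condition_robin by blast
qed

end

theory Submission
  imports Defs "HOL-Real_Asymp.Real_Asymp" "Jordan_Normal_Form.Determinant"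
begin

text \<open>
  An eigenfunction with eigenvalue \<open>k\<^sup>2\<close> is \<open>A * cos (k * x) + B * sin (k * x)\<close> on each edge. Its squared
  modulus is the constant \<open>(|A|\<^sup>2 + |B|\<^sup>2) / 2\<close>, the intensity, plus terms that oscillate with frequency
  \<open>2 * k\<close>. By the Riemann-Lebesgue lemma the oscillating terms contribute nothing in the limit to the
  integral over a measurable set, so that the mass on \<open>\<omega>\<close> is asymptotically the sum over the edges of
  \<open>|\<omega> \<inter> e|\<close> times the intensity (\<open>mass_tendsto\<close>). For normalized eigenfunctions the intensities stay in
  a compact set (\<open>eigenfunction_intensity_bounded\<close>). Along a subsequence of almost optimal
  eigenfunctions they converge to an attainable vector, at which the limit of the infima is attained
  (\<open>localization_constant_attained\<close>). The right-hand side depends on \<open>\<omega>\<close> only through the edgewise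
  measures, hence so does the localization constant.

  All this would be empty if there were no eigenvalues above some bound. That they exist
  (\<open>normalized_eigenfunction_exists\<close>) is proved without spectral theory. For fixed \<open>k\<close> the vertex
  conditions are a square real linear system for the amplitudes. If it were uniquely solvable for all
  large \<open>k\<close>, one could load it at one edge end and observe the response \<open>h k\<close> there. This function plays
  the role of a Weyl function: Green's formula expresses its derivative by the energy of the solution,
  and the energy controls the boundary data, which yields the Riccati inequality
  \<open>h' \<ge> c / k * (1 + h\<^sup>2)\<close>. Its solutions blow up before \<open>ln k\<close> has increased by \<open>pi / c\<close>, which is a
  contradiction (\<open>secular_frequency_exists\<close>).
\<close>

section \<open>Oscillatory integrals over measurable sets\<close>

lemma set_integrable_bounded_continuous:
  fixes f :: "real \<Rightarrow> real"
  assumes S: "S \<in> lmeasurable" and f: "continuous_on UNIV f" "\<And>x. \<bar>f x\<bar> \<le> C"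
  shows "set_integrable lebesgue S f"
    and "\<bar>LINT x:S|lebesgue. f x\<bar> \<le> C * measure lebesgue S"
proof -
  have C0: "C \<ge> 0" using f(2)[of 0] by linarith
  have iS: "integrable lebesgue (\<lambda>x. C * indicator S x :: real)"
    using S by (intro integrable_mult_right) (auto simp: fmeasurable_def)
  have m: "f \<in> borel_measurable lebesgue"
    using f(1) by (metis borel_measurable_continuous_onI measurable_completion measurable_lborel2)
  have mS: "S \<in> sets lebesgue" using S by auto
  have bd: "\<bar>indicator S x * f x\<bar> \<le> C * indicator S x" for x
    using f(2)[of x] C0 by (auto simp: indicator_def)
  show int: "set_integrable lebesgue S f"
    unfolding set_integrable_def
    by (rule Bochner_Integration.integrable_bound[OF iS]) (use mS m order_trans[OF bd abs_ge_self] in auto)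
  have "\<bar>LINT x:S|lebesgue. f x\<bar> \<le> (LINT x|lebesgue. \<bar>indicator S x * f x\<bar>)"
    unfolding set_lebesgue_integral_def by simp
  also have "\<dots> \<le> (LINT x|lebesgue. C * indicator S x)"
    by (rule integral_mono) (use int iS bd in \<open>auto simp: set_integrable_def\<close>)
  also have "\<dots> = C * measure lebesgue S" using mS by simp
  finally show "\<bar>LINT x:S|lebesgue. f x\<bar> \<le> C * measure lebesgue S" .
qed

lemma integral_cos_interval:
  fixes k b \<phi> :: real
  assumes "k \<noteq> 0" "b \<ge> 0"
  shows "(LINT x:{0..b}|lebesgue. cos (k * x + \<phi>)) = (sin (k * b + \<phi>) - sin \<phi>) / k"
proof -
  have "((\<lambda>x. cos (k * x + \<phi>)) has_integral (sin (k * b + \<phi>) / k - sin (k * 0 + \<phi>) / k)) {0..b}"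
    using assms
    by (intro fundamental_theorem_of_calculus)
       (auto intro!: derivative_eq_intros simp flip: has_real_derivative_iff_has_vector_derivative)
  moreover have "(LINT x:{0..b}|lebesgue. cos (k * x + \<phi>)) = integral {0..b} (\<lambda>x. cos (k * x + \<phi>))"
    by (intro set_lebesgue_integral_eq_integral set_integrable_bounded_continuous[where C=1])
       (auto intro!: continuous_intros)
  ultimately show ?thesis using assms by (simp add: integral_unique diff_divide_distrib)
qed

text \<open>
  The sets on which the oscillatory integral tends to 0 form a Dynkin system: complements because the
  claim holds on the whole interval, disjoint unions because the integral over each piece is at most
  its measure, so that the sum may be passed to the limit. Half-lines generate the Borel sets, and on
  them the integral is explicit and \<open>O(1/k)\<close>.
\<close>
lemma riemann_lebesgue_borel:
  fixes A :: "real set" and L \<phi> :: real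
  assumes "A \<in> sets borel"
  shows "((\<lambda>k. LINT x:A \<inter> {0..L}|lebesgue. cos (k * x + \<phi>)) \<longlongrightarrow> 0) at_top"
proof -
  let ?I = "\<lambda>A k. LINT x:A \<inter> {0..L}|lebesgue. cos (k * x + \<phi>)"
  have cc: "continuous_on UNIV (\<lambda>x. cos (k * x + \<phi>))" for k
    by (intro continuous_intros)
  have meas: "A \<inter> {0..L} \<in> lmeasurable" if "A \<in> sets borel" for A
    using that by (metis Int_commute bounded_Int bounded_closed_interval bounded_set_imp_lmeasurable sets.Int
        sets_completionI_sets sets_lborel borel_closed closed_atLeastAtMost)
  have int: "set_integrable lebesgue (A \<inter> {0..L}) (\<lambda>x. cos (k * x + \<phi>))"
    and bd: "\<bar>?I A k\<bar> \<le> measure lebesgue (A \<inter> {0..L})" if "A \<in> sets borel" for A k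
    using set_integrable_bounded_continuous[OF meas[OF that] cc, of k 1] by simp_all
  have half_line: "(?I {..a} \<longlongrightarrow> 0) at_top" for a
  proof (cases "min a L \<ge> 0")
    case True
    have eq: "{..a} \<inter> {0..L} = {0..min a L}" by auto
    have "((\<lambda>k::real. 2 / k) \<longlongrightarrow> 0) at_top" by real_asymp
    moreover have "\<forall>\<^sub>F k in at_top. norm (?I {..a} k) \<le> 2 / k"
      using eventually_gt_at_top[of 0]
    proof eventually_elim
      case (elim k)
      have "\<bar>sin (k * min a L + \<phi>) - sin \<phi>\<bar> \<le> 2"
        using sin_le_one[of "k * min a L + \<phi>"] sin_ge_minus_one[of "k * min a L + \<phi>"]
          sin_le_one[of \<phi>] sin_ge_minus_one[of \<phi>] by linarith
      then show ?case unfolding eq using elim True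
        by (subst integral_cos_interval) (auto simp: divide_right_mono)
    qed
    ultimately show ?thesis by (rule Lim_null_comparison[rotated])
  next
    case False
    then have eq: "{..a} \<inter> {0..L} = {}" by auto
    show ?thesis unfolding eq by (simp add: set_lebesgue_integral_def)
  qed
  have sb: "sets borel = sigma_sets UNIV (range (\<lambda>a::real. {..a}))"
    unfolding borel_eq_atMost by (simp add: sets_measure_of)
  have stable: "Int_stable (range (\<lambda>a::real. {..a}))"
    by (auto simp: Int_stable_def intro!: exI[of _ "min _ _"])
  from assms have gen: "A \<in> sigma_sets UNIV (range (\<lambda>a::real. {..a}))" unfolding sb .
  have sub: "range (\<lambda>a::real. {..a}) \<subseteq> Pow UNIV" by auto
  from stable sub gen show ?thesis
  proof (induction rule: sigma_sets_induct_disjoint)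
    case (basic A)
    then show ?case using half_line by auto
  next
    case empty
    show ?case by (simp add: set_lebesgue_integral_def)
  next
    case (compl A)
    have b: "A \<in> sets borel" using compl(1) unfolding sb .
    then have b': "UNIV - A \<in> sets borel" by auto
    have "?I {..L} k = ?I A k + ?I (UNIV - A) k" for k
    proof -
      have "{..L} \<inter> {0..L} = (A \<inter> {0..L}) \<union> ((UNIV - A) \<inter> {0..L})" by auto
      then show ?thesis
        using set_integral_Un[OF _ int[OF b, of k] int[OF b', of k]] by auto
    qed
    then have "?I (UNIV - A) = (\<lambda>k. ?I {..L} k - ?I A k)" by auto
    then show ?case using tendsto_diff[OF half_line[of L] compl(2)] by simp
  next
    case (union A)
    have b: "A i \<in> sets borel" for i using union(2) unfolding sb by auto
    have bU: "(\<Union>i. A i) \<in> sets borel" using b by auto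
    let ?M = "\<lambda>i. measure lebesgue (A i \<inter> {0..L})"
    have disj: "disjoint_family (\<lambda>i. A i \<inter> {0..L})"
      using union(1) by (auto simp: disjoint_family_on_def)
    have Int_Un: "(\<Union>i. A i) \<inter> {0..L} = (\<Union>i. A i \<inter> {0..L})" by auto
    have "?M sums measure lebesgue (\<Union>i. A i \<inter> {0..L})"
      using meas[OF b] meas[OF bU] disj unfolding Int_Un
      by (intro measure_UNION) (auto simp: fmeasurable_def)
    then have summ: "summable ?M" by (rule sums_summable)
    have ev: "\<forall>\<^sub>F (i, k) in at_top \<times>\<^sub>F at_top. norm (?I (A i) k) \<le> ?M i"
      using bd[OF b] by (intro always_eventually) (simp add: split_beta)
    have lim: "((\<lambda>k. \<Sum>i. ?I (A i) k) \<longlongrightarrow> 0) at_top"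
      using tannerys_theorem[where a = "\<lambda>i. ?I (A i)" and b = "\<lambda>_. 0" and F = at_top and M = "?M",
          OF union(3) ev summ trivial_limit_at_top_linorder]
      by (simp only: suminf_zero)
    have mi: "A i \<inter> {0..L} \<in> sets lebesgue" for i
      using meas[OF b] by (rule fmeasurableD)
    have di: "(A i \<inter> {0..L}) \<inter> (A j \<inter> {0..L}) = {}" if "i \<noteq> j" for i j
      using union(1) that by (auto simp: disjoint_family_on_def)
    have iU: "set_integrable lebesgue (\<Union>i. A i \<inter> {0..L}) (\<lambda>x. cos (k * x + \<phi>))" for k
      using int[OF bU] unfolding Int_Un .
    have "?I (\<Union>i. A i) k = (\<Sum>i. ?I (A i) k)" for k
      unfolding Int_Un by (rule lebesgue_integral_countable_add[OF mi di iU])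
    then show ?case using lim by presburger
  qed
qed

lemma riemann_lebesgue:
  fixes S :: "real set" and L \<phi> :: real
  assumes S: "S \<in> sets lebesgue" "S \<subseteq> {0..L}"
  shows "((\<lambda>k. LINT x:S|lebesgue. cos (k * x + \<phi>)) \<longlongrightarrow> 0) at_top"
proof -
  obtain B N where BN: "B \<in> sets borel" "negligible N" "B \<union> N = S"
    using sets_lebesgue_almost_borel[OF S(1)] .
  have "(LINT x:S|lebesgue. cos (k * x + \<phi>)) = (LINT x:B \<inter> {0..L}|lebesgue. cos (k * x + \<phi>))" for k
  proof -
    have N: "N \<in> null_sets lebesgue" using BN(2) by (simp add: negligible_iff_null_sets)
    have B: "B \<subseteq> S" "B \<subseteq> {0..L}" using BN S by auto
    show ?thesis unfolding set_lebesgue_integral_def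
    proof (rule integral_cong_AE)
      show "AE x in lebesgue. indicat_real S x *\<^sub>R cos (k * x + \<phi>)
          = indicat_real (B \<inter> {0..L}) x *\<^sub>R cos (k * x + \<phi>)"
        using AE_not_in[OF N] by eventually_elim (use BN B in \<open>auto simp: indicator_def\<close>)
      have m: "(\<lambda>x. cos (k * x + \<phi>)) \<in> borel_measurable lebesgue"
        by (rule measurable_completion) simp
      have "B \<inter> {0..L} \<in> sets lebesgue" using BN(1) by auto
      with m S(1) show "(\<lambda>x. indicat_real S x *\<^sub>R cos (k * x + \<phi>)) \<in> borel_measurable lebesgue"
        "(\<lambda>x. indicat_real (B \<inter> {0..L}) x *\<^sub>R cos (k * x + \<phi>)) \<in> borel_measurable lebesgue"
        by auto
    qed
  qed
  then show ?thesis using riemann_lebesgue_borel[OF BN(1), of L \<phi>] by simp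
qed

text \<open>
  The integrand is the squared modulus of \<open>A * cos (k * x) + B * sin (k * x)\<close>, with
  \<open>a = |A|\<^sup>2\<close>, \<open>b = |B|\<^sup>2\<close> and \<open>c = Re (A * cnj B)\<close>; these three numbers satisfy the conditions
  below by the inequality of the means. The double angle formulas turn it into the constant
  \<open>(a + b) / 2\<close> plus terms of frequency \<open>2 * k\<close>, which the Riemann-Lebesgue lemma kills. The threshold
  for \<open>k\<close> does not depend on \<open>a\<close>, \<open>b\<close>, \<open>c\<close>, so that the estimate can be applied to all eigenfunctions
  at once.
\<close>
lemma quadratic_mass:
  fixes S :: "real set" and L \<epsilon> :: real
  assumes S: "S \<in> sets lebesgue" "S \<subseteq> {0..L}" and "\<epsilon> > 0"
  shows "\<forall>\<^sub>F k in at_top. \<forall>a b c::real. \<bar>c\<bar> \<le> (a + b) / 2 \<longrightarrow> a \<ge> 0 \<longrightarrow> b \<ge> 0 \<longrightarrow>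
     \<bar>(LINT x:S|lebesgue. a * (cos (k * x))\<^sup>2 + b * (sin (k * x))\<^sup>2 + 2 * c * (cos (k * x) * sin (k * x)))
       - measure lebesgue S * ((a + b) / 2)\<bar> \<le> \<epsilon> * ((a + b) / 2)"
proof -
  let ?C = "\<lambda>k. LINT x:S|lebesgue. cos (2 * k * x)"
  let ?S = "\<lambda>k. LINT x:S|lebesgue. sin (2 * k * x)"
  have mS: "S \<in> lmeasurable"
    using S by (meson bounded_closed_interval bounded_set_imp_lmeasurable bounded_subset)
  have fl: "filterlim (\<lambda>k::real. 2 * k) at_top at_top" by real_asymp
  have C: "(?C \<longlongrightarrow> 0) at_top"
    using filterlim_compose[OF riemann_lebesgue[OF S, of 0] fl] by simp
  have sc: "sin x = cos (x + (- pi / 2))" for x :: real by (simp add: cos_diff)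
  have Sn: "(?S \<longlongrightarrow> 0) at_top"
    unfolding sc using filterlim_compose[OF riemann_lebesgue[OF S, of "- pi / 2"] fl] by simp
  have "((\<lambda>k. \<bar>?C k\<bar> + \<bar>?S k\<bar>) \<longlongrightarrow> 0) at_top"
    using tendsto_add[OF tendsto_rabs[OF C] tendsto_rabs[OF Sn]] by simp
  then have "\<forall>\<^sub>F k in at_top. \<bar>?C k\<bar> + \<bar>?S k\<bar> < \<epsilon>" using \<open>\<epsilon> > 0\<close>
    by (rule order_tendstoD(2))
  then show ?thesis
  proof eventually_elim
    case (elim k)
    have ic: "set_integrable lebesgue S (\<lambda>x. cos (2 * k * x))"
      by (rule set_integrable_bounded_continuous[OF mS, where C=1]) (auto intro!: continuous_intros)
    have is': "set_integrable lebesgue S (\<lambda>x. sin (2 * k * x))"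
      by (rule set_integrable_bounded_continuous[OF mS, where C=1]) (auto intro!: continuous_intros)
    have i1: "set_integrable lebesgue S (\<lambda>x. r)" for r :: real
      by (rule set_integrable_bounded_continuous[OF mS, where C="\<bar>r\<bar>"]) (auto intro!: continuous_intros)
    show ?case
    proof (intro allI impI)
      fix a b c :: real assume abc: "\<bar>c\<bar> \<le> (a + b) / 2" "a \<ge> 0" "b \<ge> 0"
      have "(LINT x:S|lebesgue. a * (cos (k * x))\<^sup>2 + b * (sin (k * x))\<^sup>2 + 2 * c * (cos (k * x) * sin (k * x)))
         = (LINT x:S|lebesgue. (a + b) / 2 + ((a - b) / 2 * cos (2 * k * x) + c * sin (2 * k * x)))"
      proof (rule arg_cong[where f="set_lebesgue_integral lebesgue S"], rule ext)
        fix x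
        have c2: "cos (2 * k * x) = (cos (k * x))\<^sup>2 - (sin (k * x))\<^sup>2"
          using cos_double[of "k * x"] by (simp add: mult.assoc)
        have s2: "sin (2 * k * x) = 2 * sin (k * x) * cos (k * x)"
          using sin_double[of "k * x"] by (simp add: mult.assoc)
        have one: "(sin (k * x))\<^sup>2 = 1 - (cos (k * x))\<^sup>2" by (simp add: sin_squared_eq)
        show "a * (cos (k * x))\<^sup>2 + b * (sin (k * x))\<^sup>2 + 2 * c * (cos (k * x) * sin (k * x))
          = (a + b) / 2 + ((a - b) / 2 * cos (2 * k * x) + c * sin (2 * k * x))"
          unfolding c2 s2 one by (simp add: field_simps)
      qed
      also have "\<dots> = (a + b) / 2 * measure lebesgue S + ((a - b) / 2 * ?C k + c * ?S k)"
        using ic is' i1 mS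
        by (subst set_integral_add(2); (subst set_integral_add(2))?)
           (auto simp: set_integral_const fmeasurable_def field_simps)
      finally have "\<bar>(LINT x:S|lebesgue. a * (cos (k * x))\<^sup>2 + b * (sin (k * x))\<^sup>2 + 2 * c * (cos (k * x) * sin (k * x)))
         - measure lebesgue S * ((a + b) / 2)\<bar> = \<bar>(a - b) / 2 * ?C k + c * ?S k\<bar>" by simp
      also have "\<dots> \<le> \<bar>(a - b) / 2\<bar> * \<bar>?C k\<bar> + \<bar>c\<bar> * \<bar>?S k\<bar>"
        by (metis abs_mult abs_triangle_ineq)
      also have "\<dots> \<le> (a + b) / 2 * \<bar>?C k\<bar> + (a + b) / 2 * \<bar>?S k\<bar>"
        using abc by (intro add_mono mult_right_mono) auto
      also have "\<dots> = (a + b) / 2 * (\<bar>?C k\<bar> + \<bar>?S k\<bar>)" by (simp add: algebra_simps)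
      also have "\<dots> \<le> (a + b) / 2 * \<epsilon>"
        using abc elim by (intro mult_left_mono) auto
      finally show "\<bar>(LINT x:S|lebesgue. a * (cos (k * x))\<^sup>2 + b * (sin (k * x))\<^sup>2 + 2 * c * (cos (k * x) * sin (k * x)))
         - measure lebesgue S * ((a + b) / 2)\<bar> \<le> \<epsilon> * ((a + b) / 2)" by (simp add: mult.commute)
    qed
  qed
qed

section \<open>Linear systems depending continuously on a parameter\<close>

lemma continuous_on_det:
  fixes a :: "'t::topological_space \<Rightarrow> nat \<Rightarrow> nat \<Rightarrow> real"
  assumes "\<And>i j. i < n \<Longrightarrow> j < n \<Longrightarrow> continuous_on T (\<lambda>t. a t i j)"
  shows "continuous_on T (\<lambda>t. det (mat n n (\<lambda>(i, j). a t i j)))"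
proof -
  have "det (mat n n (\<lambda>(i, j). a t i j))
      = (\<Sum>p \<in> {p. p permutes {0..<n}}. signof p * (\<Prod>i = 0..<n. a t i (p i)))" for t
    by (subst det_def'[of _ n])
       (auto intro!: sum.cong prod.cong simp: permutes_in_image[where S="{0..<n}", simplified])
  then show ?thesis
    by (auto intro!: continuous_intros assms simp: permutes_in_image[where S="{0..<n}", simplified])
qed

text \<open>
  Cramer's rule, written with the adjugate: the entries of the adjugate and the determinant are
  polynomials in the entries of the matrix, and the determinant has no zero on \<open>T\<close>. The rows and columns
  are indexed by an arbitrary finite set because the unknowns below are attached to the ends of edges.
\<close>
lemma continuous_solution_of_linear_system:
  fixes K :: "'t::topological_space \<Rightarrow> 'b \<Rightarrow> 'b \<Rightarrow> real" and x :: "'b \<Rightarrow> real"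
  assumes B: "finite B"
    and cont: "\<And>p q. p \<in> B \<Longrightarrow> q \<in> B \<Longrightarrow> continuous_on T (\<lambda>t. K t p q)"
    and inj: "\<And>t y p. t \<in> T \<Longrightarrow> (\<And>p. p \<in> B \<Longrightarrow> (\<Sum>q\<in>B. K t p q * y q) = 0) \<Longrightarrow> p \<in> B \<Longrightarrow> y p = 0"
  obtains Y where "\<And>t p. t \<in> T \<Longrightarrow> p \<in> B \<Longrightarrow> (\<Sum>q\<in>B. K t p q * Y t q) = x p"
    and "\<And>p. p \<in> B \<Longrightarrow> continuous_on T (\<lambda>t. Y t p)"
proof -
  define n where "n = card B"
  obtain g where g: "bij_betw g {0..<n} B"
    using ex_bij_betw_nat_finite[OF B] unfolding n_def by blast
  have gB: "g i \<in> B" if "i < n" for i using g that by (auto simp: bij_betw_def)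
  define h where "h = inv_into {0..<n} g"
  have hg: "h (g i) = i" if "i < n" for i
    unfolding h_def using g that by (auto simp: bij_betw_def intro: inv_into_f_f)
  have h: "h p < n" "g (h p) = p" if "p \<in> B" for p
    using that g unfolding h_def
    by (auto simp: bij_betw_def f_inv_into_f dest: inv_into_into[of p g "{0..<n}"])
  have sumB: "(\<Sum>q\<in>B. F q) = (\<Sum>j\<in>{0..<n}. F (g j))" for F :: "'b \<Rightarrow> real"
    using sum.reindex_bij_betw[OF g, of F] by simp
  define A where "A t = mat n n (\<lambda>(i, j). K t (g i) (g j))" for t
  have A: "A t \<in> carrier_mat n n" for t unfolding A_def by simp
  have det: "det (A t) \<noteq> 0" if t: "t \<in> T" for t
  proof
    assume "det (A t) = 0"
    then obtain v where v: "v \<in> carrier_vec n" "v \<noteq> 0\<^sub>v n" "A t *\<^sub>v v = 0\<^sub>v n"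
      using det_0_iff_vec_prod_zero[OF A] by blast
    have "(\<Sum>q\<in>B. K t p q * v $ h q) = 0" if p: "p \<in> B" for p
    proof -
      have "(A t *\<^sub>v v) $ h p = (\<Sum>j\<in>{0..<n}. K t p (g j) * v $ j)"
        using v(1) h[OF p] by (simp add: A_def scalar_prod_def)
      moreover have "(A t *\<^sub>v v) $ h p = 0" using v(3) h[OF p] by simp
      ultimately show ?thesis unfolding sumB by (simp add: hg)
    qed
    then have "v $ h p = 0" if "p \<in> B" for p using inj[OF t, of "\<lambda>q. v $ h q"] that by blast
    then have "v $ i = 0" if "i < n" for i using gB[OF that] hg[OF that] by metis
    then have "v = 0\<^sub>v n" using v(1) by auto
    then show False using v(2) by simp
  qed
  have det_cont: "continuous_on T (\<lambda>t. det (A t))"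
    unfolding A_def by (intro continuous_on_det cont gB)
  have adj_cont: "continuous_on T (\<lambda>t. adj_mat (A t) $$ (i, j))" if ij: "i < n" "j < n" for i j
  proof -
    let ?s = "\<lambda>m m'. if m' < m then m' else Suc m'"
    have "adj_mat (A t) $$ (i, j)
        = (-1) ^ (j + i) * det (mat (n - 1) (n - 1) (\<lambda>(i', j'). K t (g (?s j i')) (g (?s i j'))))" for t
    proof -
      have "mat_delete (A t) j i = mat (n - 1) (n - 1) (\<lambda>(i', j'). K t (g (?s j i')) (g (?s i j')))"
        unfolding mat_delete_def A_def using ij by (intro eq_matI) auto
      then show ?thesis unfolding adj_mat_def cofactor_def using ij by (simp add: A_def)
    qed
    then show ?thesis using ij
      by (auto intro!: continuous_intros continuous_on_det cont gB)
  qed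
  define Y where "Y t q = (\<Sum>i\<in>{0..<n}. adj_mat (A t) $$ (h q, i) * x (g i)) / det (A t)" for t q
  show ?thesis
  proof
    fix t p assume t: "t \<in> T" and p: "p \<in> B"
    have adj: "adj_mat (A t) \<in> carrier_mat n n" "A t * adj_mat (A t) = det (A t) \<cdot>\<^sub>m 1\<^sub>m n"
      using adj_mat[OF A] by auto
    have row: "(\<Sum>j\<in>{0..<n}. K t p (g j) * adj_mat (A t) $$ (j, i)) = (if i = h p then det (A t) else 0)"
      if "i < n" for i
    proof -
      have "(A t * adj_mat (A t)) $$ (h p, i) = (\<Sum>j\<in>{0..<n}. K t p (g j) * adj_mat (A t) $$ (j, i))"
        using adj(1) A h[OF p] that by (simp add: A_def scalar_prod_def)
      then show ?thesis unfolding adj(2) using h[OF p] that by auto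
    qed
    have "(\<Sum>q\<in>B. K t p q * Y t q)
        = (\<Sum>j\<in>{0..<n}. \<Sum>i\<in>{0..<n}. K t p (g j) * adj_mat (A t) $$ (j, i) * (x (g i) / det (A t)))"
      unfolding sumB Y_def
      by (intro sum.cong refl) (simp add: hg sum_divide_distrib sum_distrib_left mult.assoc)
    also have "\<dots> = (\<Sum>i\<in>{0..<n}. (\<Sum>j\<in>{0..<n}. K t p (g j) * adj_mat (A t) $$ (j, i)) * (x (g i) / det (A t)))"
      by (subst sum.swap) (simp only: sum_distrib_right)
    also have "\<dots> = (\<Sum>i\<in>{0..<n}. if i = h p then x (g i) else 0)"
      by (intro sum.cong refl) (use det[OF t] in \<open>simp add: row\<close>)
    also have "\<dots> = x p" using h[OF p] by simp
    finally show "(\<Sum>q\<in>B. K t p q * Y t q) = x p" .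
  next
    fix p assume "p \<in> B"
    then show "continuous_on T (\<lambda>t. Y t p)"
      unfolding Y_def by (intro continuous_intros adj_cont det_cont) (use h det in auto)
  qed
qed

section \<open>Vertex conditions as a rotation of boundary data\<close>

locale metric_graph = fin_digraph G for G :: "('v, 'e) pre_digraph" +
  fixes l :: "'e \<Rightarrow> real"
  assumes arcs_nonempty: "arcs G \<noteq> {}"
    and length_pos: "e \<in> arcs G \<Longrightarrow> l e > 0"
begin

text \<open>
  An edge end is a pair of an edge and a flag that is true for the head and false for the tail. A loop
  has two ends at the same vertex.
\<close>
definition edge_ends :: "('e \<times> bool) set" where
  "edge_ends = arcs G \<times> UNIV"

definition vertex_at :: "'e \<times> bool \<Rightarrow> 'v" where
  "vertex_at p = (if snd p then head G (fst p) else tail G (fst p))"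

definition ends_at :: "'v \<Rightarrow> ('e \<times> bool) set" where
  "ends_at v = {p \<in> edge_ends. vertex_at p = v}"

definition vertex_avg :: "('e \<times> bool \<Rightarrow> real) \<Rightarrow> 'v \<Rightarrow> real" where
  "vertex_avg f v = (\<Sum>p\<in>ends_at v. f p) / card (ends_at v)"

lemma finite_edge_ends [simp]: "finite edge_ends"
  by (simp add: edge_ends_def)

lemma finite_ends_at [simp]: "finite (ends_at v)"
  by (simp add: ends_at_def)

lemma sum_edge_ends: "(\<Sum>p\<in>edge_ends. F p) = (\<Sum>e\<in>arcs G. F (e, False) + F (e, True))"
  for F :: "'e \<times> bool \<Rightarrow> 'x::comm_monoid_add"
proof -
  have "(\<Sum>p\<in>edge_ends. F p) = (\<Sum>e\<in>arcs G. \<Sum>b\<in>UNIV. F (e, b))"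
    unfolding edge_ends_def by (simp add: sum.cartesian_product)
  then show ?thesis by (simp add: UNIV_bool)
qed

lemma ends_at_self: "p \<in> edge_ends \<Longrightarrow> p \<in> ends_at (vertex_at p)"
  by (simp add: ends_at_def)

lemma vertex_avg_const:
  assumes "ends_at v \<noteq> {}" "\<And>p. p \<in> ends_at v \<Longrightarrow> f p = c"
  shows "vertex_avg f v = c"
  unfolding vertex_avg_def using assms by simp

lemma vertex_avg_cong:
  "(\<And>p. p \<in> ends_at v \<Longrightarrow> f p = g p) \<Longrightarrow> vertex_avg f v = vertex_avg g v"
  unfolding vertex_avg_def by (simp cong: sum.cong)

lemma vertex_avg_add: "vertex_avg (\<lambda>p. f p + g p) v = vertex_avg f v + vertex_avg g v"
  unfolding vertex_avg_def by (simp add: sum.distrib add_divide_distrib)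

lemma vertex_avg_diff: "vertex_avg (\<lambda>p. f p - g p) v = vertex_avg f v - vertex_avg g v"
  unfolding vertex_avg_def by (simp add: sum_subtractf diff_divide_distrib)

lemma vertex_avg_cmult: "vertex_avg (\<lambda>p. c * f p) v = c * vertex_avg f v"
  unfolding vertex_avg_def by (simp add: sum_distrib_left)

lemma vertex_avg_vertex_fun:
  assumes "p \<in> edge_ends"
  shows "vertex_avg (\<lambda>q. \<phi> (vertex_at q)) (vertex_at p) = \<phi> (vertex_at p)"
proof (rule vertex_avg_const)
  show "ends_at (vertex_at p) \<noteq> {}" using ends_at_self[OF assms] by blast
qed (simp add: ends_at_def)

lemma vertex_avg_symmetric:
  "(\<Sum>p\<in>edge_ends. vertex_avg f (vertex_at p) * g p) = (\<Sum>p\<in>edge_ends. vertex_avg g (vertex_at p) * f p)"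
proof -
  define N where "N p = real (card (ends_at (vertex_at p)))" for p
  have eq: "vertex_avg f (vertex_at p) * g p
      = (\<Sum>q\<in>edge_ends. if vertex_at q = vertex_at p then f q * g p / N p else 0)" for f g p
    unfolding vertex_avg_def ends_at_def N_def
    by (simp add: sum.inter_filter sum_distrib_right sum_divide_distrib if_distrib[of "\<lambda>x. x * _"]
        if_distrib[of "\<lambda>x. x / _"] cong: if_cong)
  show ?thesis
    unfolding eq by (subst sum.swap, intro sum.cong refl) (auto simp: N_def)
qed

text \<open>
  Averaging over the ends at each vertex is an orthogonal projection, so that the scalar product splits
  into the contributions of fluctuations and of averages.
\<close>
lemma sum_mult_split:
  "(\<Sum>p\<in>edge_ends. f p * g p)
   = (\<Sum>p\<in>edge_ends. (f p - vertex_avg f (vertex_at p)) * (g p - vertex_avg g (vertex_at p))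
        + vertex_avg f (vertex_at p) * vertex_avg g (vertex_at p))"
proof -
  let ?a = "\<lambda>f p. vertex_avg f (vertex_at p)"
  have 1: "(\<Sum>p\<in>edge_ends. ?a f p * g p) = (\<Sum>p\<in>edge_ends. ?a f p * ?a g p)" for f g
  proof -
    have "(\<Sum>p\<in>edge_ends. ?a f p * g p) = (\<Sum>p\<in>edge_ends. ?a (?a f) p * g p)"
      by (intro sum.cong refl) (simp add: vertex_avg_vertex_fun[where \<phi>="vertex_avg f"])
    also have "\<dots> = (\<Sum>p\<in>edge_ends. ?a g p * ?a f p)" by (rule vertex_avg_symmetric)
    finally show ?thesis by (simp add: mult.commute)
  qed
  have "(\<Sum>p\<in>edge_ends. (f p - ?a f p) * (g p - ?a g p) + ?a f p * ?a g p)
      = (\<Sum>p\<in>edge_ends. f p * g p) - (\<Sum>p\<in>edge_ends. ?a f p * g p) - (\<Sum>p\<in>edge_ends. ?a g p * f p)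
        + 2 * (\<Sum>p\<in>edge_ends. ?a f p * ?a g p)"
    unfolding sum_subtractf[symmetric] sum.distrib[symmetric] sum_distrib_left
    by (intro sum.cong refl) (simp add: algebra_simps)
  also have "\<dots> = (\<Sum>p\<in>edge_ends. f p * g p)"
    unfolding 1[of f g] 1[of g f] by (simp add: mult.commute)
  finally show ?thesis ..
qed

text \<open>
  For the projection \<open>P\<close> onto vertex averages put \<open>C = 1 - P + cos \<theta> * P\<close> and \<open>S = sin \<theta> * P\<close>. These are
  commuting self-adjoint operators with \<open>C\<^sup>2 + S\<^sup>2 = 1\<close>; \<open>cos_data\<close> is \<open>C f + S g\<close> and \<open>sin_data\<close> is
  \<open>C g - S f\<close>. For boundary values \<open>f\<close> and outgoing slopes \<open>g\<close>, the equation \<open>C f + S g = 0\<close> contains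
  all vertex conditions at once. With \<open>\<theta> = pi / 2\<close> at a vertex it says that the fluctuation of \<open>f\<close> and
  the average of \<open>g\<close> vanish there, which is the Kirchhoff condition. At a vertex with a single end \<open>P\<close>
  is the identity, and it says \<open>cos \<theta> * f + sin \<theta> * g = 0\<close>, which is the general separated
  self-adjoint condition.
\<close>
definition cos_data :: "('v \<Rightarrow> real) \<Rightarrow> ('e \<times> bool \<Rightarrow> real) \<Rightarrow> ('e \<times> bool \<Rightarrow> real) \<Rightarrow> 'e \<times> bool \<Rightarrow> real" where
  "cos_data \<theta> f g p = f p - vertex_avg f (vertex_at p)
     + cos (\<theta> (vertex_at p)) * vertex_avg f (vertex_at p) + sin (\<theta> (vertex_at p)) * vertex_avg g (vertex_at p)"

definition sin_data :: "('v \<Rightarrow> real) \<Rightarrow> ('e \<times> bool \<Rightarrow> real) \<Rightarrow> ('e \<times> bool \<Rightarrow> real) \<Rightarrow> 'e \<times> bool \<Rightarrow> real" where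
  "sin_data \<theta> f g p = g p - vertex_avg g (vertex_at p)
     + cos (\<theta> (vertex_at p)) * vertex_avg g (vertex_at p) - sin (\<theta> (vertex_at p)) * vertex_avg f (vertex_at p)"

lemma vertex_avg_data:
  assumes "p \<in> edge_ends" and v: "v = vertex_at p"
  shows "vertex_avg (cos_data \<theta> f g) v = cos (\<theta> v) * vertex_avg f v + sin (\<theta> v) * vertex_avg g v"
    and "vertex_avg (sin_data \<theta> f g) v = cos (\<theta> v) * vertex_avg g v - sin (\<theta> v) * vertex_avg f v"
proof -
  have c: "vertex_avg (\<lambda>q. \<phi> (vertex_at q)) v = \<phi> v" for \<phi>
    unfolding v by (rule vertex_avg_vertex_fun[OF assms(1)])
  have "vertex_avg (\<lambda>q. f q - vertex_avg f (vertex_at q) + (cos (\<theta> (vertex_at q)) * vertex_avg f (vertex_at q)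
     + sin (\<theta> (vertex_at q)) * vertex_avg g (vertex_at q))) v = cos (\<theta> v) * vertex_avg f v + sin (\<theta> v) * vertex_avg g v"
    unfolding vertex_avg_add vertex_avg_diff
      c[of "\<lambda>v. cos (\<theta> v) * vertex_avg f v"] c[of "\<lambda>v. sin (\<theta> v) * vertex_avg g v"] c[of "vertex_avg f"] by simp
  then show "vertex_avg (cos_data \<theta> f g) v = cos (\<theta> v) * vertex_avg f v + sin (\<theta> v) * vertex_avg g v"
    unfolding cos_data_def[abs_def] by (simp add: add.assoc)
  have "vertex_avg (\<lambda>q. g q - vertex_avg g (vertex_at q) + (cos (\<theta> (vertex_at q)) * vertex_avg g (vertex_at q)
     - sin (\<theta> (vertex_at q)) * vertex_avg f (vertex_at q))) v = cos (\<theta> v) * vertex_avg g v - sin (\<theta> v) * vertex_avg f v"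
    unfolding vertex_avg_add vertex_avg_diff
      c[of "\<lambda>v. cos (\<theta> v) * vertex_avg g v"] c[of "\<lambda>v. sin (\<theta> v) * vertex_avg f v"] c[of "vertex_avg g"] by simp
  then show "vertex_avg (sin_data \<theta> f g) v = cos (\<theta> v) * vertex_avg g v - sin (\<theta> v) * vertex_avg f v"
    unfolding sin_data_def[abs_def] by (simp add: add_diff_eq)
qed

text \<open>
  On averages the pair \<open>(f, g)\<close> is rotated by the angle \<open>\<theta>\<close>, and fluctuations are left alone. A
  rotation preserves both the area form and the length; the latter gives the next lemma.
\<close>
lemma data_symplectic:
  "(\<Sum>p\<in>edge_ends. f p * g' p - g p * f' p)
   = (\<Sum>p\<in>edge_ends. cos_data \<theta> f g p * sin_data \<theta> f' g' p - sin_data \<theta> f g p * cos_data \<theta> f' g' p)"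
proof -
  have rot: "a * d' - b * c' = (s * b + c * a) * (c * d' - s * c') - (c * b - s * a) * (c * c' + s * d')"
    if "s\<^sup>2 + c\<^sup>2 = 1" for a b c' d' s c :: real
  proof -
    have "(s * b + c * a) * (c * d' - s * c') - (c * b - s * a) * (c * c' + s * d') = (s\<^sup>2 + c\<^sup>2) * (a * d' - b * c')"
      by (simp add: power2_eq_square algebra_simps)
    then show ?thesis using that by simp
  qed
  show ?thesis
    unfolding sum_subtractf sum_mult_split[of f] sum_mult_split[of g] sum_mult_split[of "cos_data \<theta> f g"]
      sum_mult_split[of "sin_data \<theta> f g"]
    unfolding sum_subtractf[symmetric]
  proof (rule sum.cong[OF refl])
    fix p assume p: "p \<in> edge_ends"
    let ?v = "vertex_at p"
    have r: "vertex_avg f ?v * vertex_avg g' ?v - vertex_avg g ?v * vertex_avg f' ?v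
      = (sin (\<theta> ?v) * vertex_avg g ?v + cos (\<theta> ?v) * vertex_avg f ?v) * (cos (\<theta> ?v) * vertex_avg g' ?v - sin (\<theta> ?v) * vertex_avg f' ?v)
       - (cos (\<theta> ?v) * vertex_avg g ?v - sin (\<theta> ?v) * vertex_avg f ?v) * (cos (\<theta> ?v) * vertex_avg f' ?v + sin (\<theta> ?v) * vertex_avg g' ?v)"
      by (rule rot) simp
    show "(f p - vertex_avg f ?v) * (g' p - vertex_avg g' ?v) + vertex_avg f ?v * vertex_avg g' ?v
       - ((g p - vertex_avg g ?v) * (f' p - vertex_avg f' ?v) + vertex_avg g ?v * vertex_avg f' ?v) =
      (cos_data \<theta> f g p - vertex_avg (cos_data \<theta> f g) ?v) * (sin_data \<theta> f' g' p - vertex_avg (sin_data \<theta> f' g') ?v)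
       + vertex_avg (cos_data \<theta> f g) ?v * vertex_avg (sin_data \<theta> f' g') ?v
       - ((sin_data \<theta> f g p - vertex_avg (sin_data \<theta> f g) ?v) * (cos_data \<theta> f' g' p - vertex_avg (cos_data \<theta> f' g') ?v)
       + vertex_avg (sin_data \<theta> f g) ?v * vertex_avg (cos_data \<theta> f' g') ?v)"
      unfolding vertex_avg_data[OF p refl] using r
      by (simp add: cos_data_def sin_data_def algebra_simps)
  qed
qed

lemma data_isometric:
  "(\<Sum>p\<in>edge_ends. (f p)\<^sup>2 + (g p)\<^sup>2) = (\<Sum>p\<in>edge_ends. (cos_data \<theta> f g p)\<^sup>2 + (sin_data \<theta> f g p)\<^sup>2)"
proof -
  have rot: "a * a + b * b = (c * a + s * b) * (c * a + s * b) + (c * b - s * a) * (c * b - s * a)"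
    if "s\<^sup>2 + c\<^sup>2 = 1" for a b s c :: real
  proof -
    have "(c * a + s * b) * (c * a + s * b) + (c * b - s * a) * (c * b - s * a) = (s\<^sup>2 + c\<^sup>2) * (a * a + b * b)"
      by (simp add: power2_eq_square algebra_simps)
    then show ?thesis using that by simp
  qed
  show ?thesis
    unfolding sum.distrib power2_eq_square sum_mult_split[of f] sum_mult_split[of g] sum_mult_split[of "cos_data \<theta> f g"]
      sum_mult_split[of "sin_data \<theta> f g"]
    unfolding sum.distrib[symmetric]
  proof (rule sum.cong[OF refl])
    fix p assume p: "p \<in> edge_ends"
    let ?v = "vertex_at p"
    let ?a = "vertex_avg f ?v" and ?b = "vertex_avg g ?v" and ?c = "cos (\<theta> ?v)" and ?s = "sin (\<theta> ?v)"
    have r: "?a * ?a + ?b * ?b = (?c * ?a + ?s * ?b) * (?c * ?a + ?s * ?b) + (?c * ?b - ?s * ?a) * (?c * ?b - ?s * ?a)"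
      by (rule rot) simp
    show "(f p - ?a) * (f p - ?a) + ?a * ?a + ((g p - ?b) * (g p - ?b) + ?b * ?b) =
      (cos_data \<theta> f g p - vertex_avg (cos_data \<theta> f g) ?v) * (cos_data \<theta> f g p - vertex_avg (cos_data \<theta> f g) ?v)
       + vertex_avg (cos_data \<theta> f g) ?v * vertex_avg (cos_data \<theta> f g) ?v
       + ((sin_data \<theta> f g p - vertex_avg (sin_data \<theta> f g) ?v) * (sin_data \<theta> f g p - vertex_avg (sin_data \<theta> f g) ?v)
       + vertex_avg (sin_data \<theta> f g) ?v * vertex_avg (sin_data \<theta> f g) ?v)"
      unfolding vertex_avg_data[OF p refl] using r
      by (simp add: cos_data_def sin_data_def)
  qed
qed

text \<open>
  A wave of frequency \<open>k\<close> is stored by its two amplitudes on each edge. The amplitudes are indexed by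
  edge ends, the cosine by the tail and the sine by the head, so that there are as many unknowns as
  vertex conditions. Slopes are taken in the direction into the edge.
\<close>
definition wave :: "real \<Rightarrow> ('e \<times> bool \<Rightarrow> real) \<Rightarrow> 'e \<Rightarrow> real \<Rightarrow> real" where
  "wave k y e x = y (e, False) * cos (k * x) + y (e, True) * sin (k * x)"

definition wave_deriv :: "real \<Rightarrow> ('e \<times> bool \<Rightarrow> real) \<Rightarrow> 'e \<Rightarrow> real \<Rightarrow> real" where
  "wave_deriv k y e x = k * (y (e, True) * cos (k * x) - y (e, False) * sin (k * x))"

definition end_value :: "real \<Rightarrow> ('e \<times> bool \<Rightarrow> real) \<Rightarrow> 'e \<times> bool \<Rightarrow> real" where
  "end_value k y p = wave k y (fst p) (if snd p then l (fst p) else 0)"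

definition end_slope :: "real \<Rightarrow> ('e \<times> bool \<Rightarrow> real) \<Rightarrow> 'e \<times> bool \<Rightarrow> real" where
  "end_slope k y p = (if snd p then - wave_deriv k y (fst p) (l (fst p)) else wave_deriv k y (fst p) 0)"

lemma wave_has_derivative:
  "(wave k y e has_real_derivative wave_deriv k y e x) (at x within X)"
  "(wave_deriv k y e has_real_derivative - (k\<^sup>2 * wave k y e x)) (at x within X)"
  unfolding wave_def[abs_def] wave_deriv_def[abs_def]
  by (auto intro!: derivative_eq_intros simp: algebra_simps power2_eq_square)

lemma green_edge:
  assumes "e \<in> arcs G"
  shows "(m\<^sup>2 - k\<^sup>2) * integral {0..l e} (\<lambda>x. wave k y e x * wave m z e x)
    = (\<Sum>b\<in>UNIV. end_value k y (e, b) * end_slope m z (e, b) - end_slope k y (e, b) * end_value m z (e, b))"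
proof -
  let ?F = "\<lambda>x. wave_deriv k y e x * wave m z e x - wave k y e x * wave_deriv m z e x"
  have "((\<lambda>x. (m\<^sup>2 - k\<^sup>2) * (wave k y e x * wave m z e x)) has_integral (?F (l e) - ?F 0)) {0..l e}"
    using length_pos[OF assms]
    by (intro fundamental_theorem_of_calculus)
       (auto intro!: derivative_eq_intros wave_has_derivative
          simp flip: has_real_derivative_iff_has_vector_derivative simp: algebra_simps)
  then have "integral {0..l e} (\<lambda>x. (m\<^sup>2 - k\<^sup>2) * (wave k y e x * wave m z e x)) = ?F (l e) - ?F 0"
    by (rule integral_unique)
  then show ?thesis
    by (simp add: UNIV_bool end_value_def end_slope_def)
qed

end

section \<open>The secular system\<close>

context metric_graph begin

text \<open>
  The left-hand side of the system of vertex conditions for the amplitudes \<open>y\<close>.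
\<close>
definition secular :: "('v \<Rightarrow> real) \<Rightarrow> real \<Rightarrow> ('e \<times> bool \<Rightarrow> real) \<Rightarrow> 'e \<times> bool \<Rightarrow> real" where
  "secular \<theta> k y = cos_data \<theta> (end_value k y) (end_slope k y)"

definition unit_amp :: "'e \<times> bool \<Rightarrow> 'e \<times> bool \<Rightarrow> real" where
  "unit_amp q = (\<lambda>r. if r = q then 1 else 0)"

lemma wave_expand:
  assumes "e \<in> arcs G"
  shows "wave k y e x = (\<Sum>q\<in>edge_ends. wave k (unit_amp q) e x * y q)"
    and "wave_deriv k y e x = (\<Sum>q\<in>edge_ends. wave_deriv k (unit_amp q) e x * y q)"
proof -
  have u: "y (e, b) = (\<Sum>q\<in>edge_ends. unit_amp q (e, b) * y q)" for b
  proof -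
    have "(\<Sum>q\<in>edge_ends. unit_amp q (e, b) * y q) = (\<Sum>q\<in>edge_ends. if (e, b) = q then y q else 0)"
      by (intro sum.cong refl) (simp add: unit_amp_def)
    then show ?thesis using assms by (simp add: edge_ends_def)
  qed
  show "wave k y e x = (\<Sum>q\<in>edge_ends. wave k (unit_amp q) e x * y q)"
    unfolding wave_def by (subst u[of False], subst u[of True])
      (simp add: sum_distrib_left sum_distrib_right algebra_simps sum.distrib)
  show "wave_deriv k y e x = (\<Sum>q\<in>edge_ends. wave_deriv k (unit_amp q) e x * y q)"
    unfolding wave_deriv_def by (subst u[of False], subst u[of True])
      (simp add: sum_distrib_left sum_distrib_right sum_subtractf algebra_simps)
qed

lemma vertex_avg_sum:
  "vertex_avg (\<lambda>p. \<Sum>q\<in>Q. f q p * y q) v = (\<Sum>q\<in>Q. vertex_avg (f q) v * y q)"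
  unfolding vertex_avg_def
  by (subst sum.swap) (simp add: sum_distrib_right sum_divide_distrib)

lemma secular_expand:
  assumes p: "p \<in> edge_ends"
  shows "secular \<theta> k y p = (\<Sum>q\<in>edge_ends. secular \<theta> k (unit_amp q) p * y q)"
proof -
  have v: "end_value k y p = (\<Sum>q\<in>edge_ends. end_value k (unit_amp q) p * y q)"
    and s: "end_slope k y p = (\<Sum>q\<in>edge_ends. end_slope k (unit_amp q) p * y q)"
    if "p \<in> edge_ends" for p
  proof -
    have e: "fst p \<in> arcs G" using that by (auto simp: edge_ends_def)
    show "end_value k y p = (\<Sum>q\<in>edge_ends. end_value k (unit_amp q) p * y q)"
      unfolding end_value_def by (rule wave_expand[OF e])
    show "end_slope k y p = (\<Sum>q\<in>edge_ends. end_slope k (unit_amp q) p * y q)"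
      unfolding end_slope_def
      by (cases "snd p") (simp_all add: sum_negf wave_expand(2)[OF e, of k y, symmetric])
  qed
  have av: "vertex_avg (end_value k y) w = (\<Sum>q\<in>edge_ends. vertex_avg (end_value k (unit_amp q)) w * y q)"
    and as: "vertex_avg (end_slope k y) w = (\<Sum>q\<in>edge_ends. vertex_avg (end_slope k (unit_amp q)) w * y q)" for w
    unfolding vertex_avg_sum[symmetric] by (rule vertex_avg_cong, simp add: ends_at_def v s)+
  show ?thesis
    unfolding secular_def cos_data_def v[OF p] av as
    unfolding sum_distrib_left sum.distrib[symmetric] sum_subtractf[symmetric]
    by (intro sum.cong refl) (simp add: algebra_simps)
qed

lemma wave_continuous [continuous_intros]:
  fixes T :: "'t::t2_space set"
  assumes "\<And>b. continuous_on T (\<lambda>t. Y t (e, b))" "continuous_on T \<kappa>" "continuous_on T \<xi>"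
  shows "continuous_on T (\<lambda>t. wave (\<kappa> t) (Y t) e (\<xi> t))"
    and "continuous_on T (\<lambda>t. wave_deriv (\<kappa> t) (Y t) e (\<xi> t))"
  unfolding wave_def wave_deriv_def
  by (intro continuous_on_add continuous_on_diff continuous_on_mult continuous_on_cos continuous_on_sin assms)+

lemma secular_continuous: "continuous_on T (\<lambda>k. secular \<theta> k y p)"
proof -
  have "continuous_on T (\<lambda>k. end_value k y p)" "continuous_on T (\<lambda>k. end_slope k y p)" for p
    unfolding end_value_def end_slope_def by (cases "snd p"; simp; intro continuous_intros)+
  then show ?thesis
    unfolding secular_def cos_data_def vertex_avg_def divide_inverse by (intro continuous_intros)
qed

text \<open>
  The energy on an edge is asymptotically half its length times the squared amplitudes; half of that
  is a lower bound for all large \<open>k\<close>.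
\<close>
lemma wave_energy_lower_bound:
  "\<forall>\<^sub>F k in at_top. \<forall>e\<in>arcs G. \<forall>y.
     integral {0..l e} (\<lambda>x. wave k y e x * wave k y e x) \<ge> l e / 4 * ((y (e, False))\<^sup>2 + (y (e, True))\<^sup>2)"
proof (rule eventually_ball_finite[OF finite_arcs], rule ballI)
  fix e assume "e \<in> arcs G"
  then have L: "l e > 0" by (rule length_pos)
  have "\<forall>\<^sub>F k in at_top. \<forall>a b c::real. \<bar>c\<bar> \<le> (a + b) / 2 \<longrightarrow> a \<ge> 0 \<longrightarrow> b \<ge> 0 \<longrightarrow>
     \<bar>(LINT x:{0..l e}|lebesgue. a * (cos (k * x))\<^sup>2 + b * (sin (k * x))\<^sup>2 + 2 * c * (cos (k * x) * sin (k * x)))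
       - measure lebesgue {0..l e} * ((a + b) / 2)\<bar> \<le> l e / 2 * ((a + b) / 2)"
    by (rule quadratic_mass[of _ "l e"]) (use L in auto)
  then show "\<forall>\<^sub>F k in at_top. \<forall>y. integral {0..l e} (\<lambda>x. wave k y e x * wave k y e x)
      \<ge> l e / 4 * ((y (e, False))\<^sup>2 + (y (e, True))\<^sup>2)"
  proof eventually_elim
    case (elim k)
    show ?case
    proof
      fix y :: "'e \<times> bool \<Rightarrow> real"
      let ?a = "y (e, False)" and ?b = "y (e, True)"
      let ?w = "\<lambda>x. ?a\<^sup>2 * (cos (k * x))\<^sup>2 + ?b\<^sup>2 * (sin (k * x))\<^sup>2 + 2 * (?a * ?b) * (cos (k * x) * sin (k * x))"
      have w: "wave k y e x * wave k y e x = ?w x" for x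
        unfolding wave_def by (simp add: power2_eq_square algebra_simps)
      have "\<bar>?a * ?b\<bar> \<le> (?a\<^sup>2 + ?b\<^sup>2) / 2"
        using sum_squares_bound[of "\<bar>?a\<bar>" "\<bar>?b\<bar>"] by (simp add: abs_mult)
      then have "\<bar>(LINT x:{0..l e}|lebesgue. ?w x) - l e * ((?a\<^sup>2 + ?b\<^sup>2) / 2)\<bar> \<le> l e / 2 * ((?a\<^sup>2 + ?b\<^sup>2) / 2)"
        using elim L by simp
      moreover have "(LINT x:{0..l e}|lebesgue. ?w x) = integral {0..l e} ?w"
        by (intro set_lebesgue_integral_eq_integral absolutely_integrable_continuous_real continuous_intros)
      ultimately show "integral {0..l e} (\<lambda>x. wave k y e x * wave k y e x) \<ge> l e / 4 * (?a\<^sup>2 + ?b\<^sup>2)"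
        unfolding w by argo
    qed
  qed
qed

lemma end_data_bound:
  assumes "k \<ge> 1"
  shows "(end_value k y (e, b))\<^sup>2 + (end_slope k y (e, b))\<^sup>2 \<le> k\<^sup>2 * ((y (e, False))\<^sup>2 + (y (e, True))\<^sup>2)"
proof -
  have "(wave k y e x)\<^sup>2 + (wave_deriv k y e x)\<^sup>2 \<le> k\<^sup>2 * ((y (e, False))\<^sup>2 + (y (e, True))\<^sup>2)" for x
  proof -
    have k: "1 \<le> k\<^sup>2" using assms by simp
    have rot: "k\<^sup>2 * (a * c + b * s)\<^sup>2 + (k * (b * c - a * s))\<^sup>2 = k\<^sup>2 * ((c\<^sup>2 + s\<^sup>2) * (a\<^sup>2 + b\<^sup>2))"
      for a b c s :: real by (simp add: power2_eq_square algebra_simps)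
    have "k\<^sup>2 * (wave k y e x)\<^sup>2 + (wave_deriv k y e x)\<^sup>2
       = k\<^sup>2 * (((cos (k * x))\<^sup>2 + (sin (k * x))\<^sup>2) * ((y (e, False))\<^sup>2 + (y (e, True))\<^sup>2))"
      unfolding wave_def wave_deriv_def by (rule rot)
    moreover have "(wave k y e x)\<^sup>2 \<le> k\<^sup>2 * (wave k y e x)\<^sup>2"
      using mult_right_mono[OF k, of "(wave k y e x)\<^sup>2"] by simp
    ultimately show ?thesis by simp
  qed
  then show ?thesis unfolding end_value_def end_slope_def by auto
qed

lemma green_graph:
  "(\<Sum>p\<in>edge_ends. end_value k y p * end_slope m z p - end_slope k y p * end_value m z p)
   = (m\<^sup>2 - k\<^sup>2) * (\<Sum>e\<in>arcs G. integral {0..l e} (\<lambda>x. wave k y e x * wave m z e x))"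
  unfolding sum_distrib_left sum_edge_ends
  by (intro sum.cong refl) (simp add: green_edge UNIV_bool)

end

section \<open>Existence of arbitrarily large secular frequencies\<close>

context metric_graph begin

text \<open>
  If the homogeneous system had no solution for \<open>k \<ge> K\<close>, then a unit load at one end could be solved
  for, and the response \<open>h\<close> at the same end would be a smooth real function of \<open>k\<close> on the whole half-line.
  Green's formula for two frequencies gives \<open>h' = 2 * k * J\<close> with the energy \<open>J\<close> of the solution. The
  energy dominates the boundary data divided by \<open>k\<^sup>2\<close>, and the boundary data have squared length at
  least \<open>1 + h\<^sup>2\<close>. Therefore \<open>h' \<ge> c / k * (1 + h\<^sup>2)\<close>, so that \<open>arctan h\<close> grows at least like
  \<open>c * ln k\<close>, which a bounded function cannot do.
\<close>
lemma secular_frequency_exists: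
  fixes \<theta> :: "'v \<Rightarrow> real" and K :: real
  obtains k y where "k \<ge> K" "\<exists>p\<in>edge_ends. y p \<noteq> 0" "\<And>p. p \<in> edge_ends \<Longrightarrow> secular \<theta> k y p = 0"
proof (rule ccontr)
  assume no: "\<not> thesis"
  note found = that
  obtain K1 where K1: "\<And>k e y. k \<ge> K1 \<Longrightarrow> e \<in> arcs G \<Longrightarrow>
     l e / 4 * ((y (e, False))\<^sup>2 + (y (e, True))\<^sup>2) \<le> integral {0..l e} (\<lambda>x. wave k y e x * wave k y e x)"
    using wave_energy_lower_bound unfolding eventually_at_top_linorder by blast
  define K0 where "K0 = max K (max 1 K1)"
  have K0: "K0 \<ge> K" "K0 \<ge> 1" "K0 \<ge> K1" unfolding K0_def by auto
  obtain e0 where e0: "e0 \<in> arcs G" using arcs_nonempty by blast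
  define p0 where "p0 = (e0, False)"
  have p0: "p0 \<in> edge_ends" using e0 by (simp add: p0_def edge_ends_def)
  have inj: "y p = 0"
    if k: "k \<in> {K0..}" and z: "\<And>p. p \<in> edge_ends \<Longrightarrow> (\<Sum>q\<in>edge_ends. secular \<theta> k (unit_amp q) p * y q) = 0"
      and p: "p \<in> edge_ends" for k y p
  proof (rule ccontr)
    assume "y p \<noteq> 0"
    then have "\<exists>p\<in>edge_ends. y p \<noteq> 0" using p by blast
    moreover have "secular \<theta> k y p = 0" if "p \<in> edge_ends" for p
      by (subst secular_expand[OF that]) (rule z[OF that])
    moreover have "k \<ge> K" using k K0(1) by simp
    ultimately have thesis by (intro found)
    then show False using no by blast
  qed
  obtain Y where
    Y: "\<And>k p. k \<in> {K0..} \<Longrightarrow> p \<in> edge_ends \<Longrightarrow>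
          (\<Sum>q\<in>edge_ends. secular \<theta> k (unit_amp q) p * Y k q) = unit_amp p0 p"
    and Ycont: "\<And>p. p \<in> edge_ends \<Longrightarrow> continuous_on {K0..} (\<lambda>k. Y k p)"
  proof -
    have cont: "continuous_on {K0..} (\<lambda>k. secular \<theta> k (unit_amp q) p)" for p q
      by (rule secular_continuous)
    show ?thesis
    proof (rule continuous_solution_of_linear_system[of edge_ends "{K0..}"
            "\<lambda>k p q. secular \<theta> k (unit_amp q) p" "unit_amp p0"])
      show "y p = 0" if "k \<in> {K0..}" "p \<in> edge_ends"
        "\<And>p. p \<in> edge_ends \<Longrightarrow> (\<Sum>q\<in>edge_ends. secular \<theta> k (unit_amp q) p * y q) = 0" for k y p
        by (rule inj[OF that(1) _ that(2)]) (rule that(3))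
    qed (rule finite_edge_ends, rule cont, rule that)
  qed
  (* In terms of C and S, unit_amp p0 is the load C f + S g, and w is C g - S f. *)
  define u where "u k = wave k (Y k)" for k
  define w where "w k = sin_data \<theta> (end_value k (Y k)) (end_slope k (Y k))" for k
  define h where "h k = w k p0" for k
  define J where "J k m = (\<Sum>e\<in>arcs G. integral {0..l e} (\<lambda>x. u k e x * u m e x))" for k m
  have x: "cos_data \<theta> (end_value k (Y k)) (end_slope k (Y k)) p = unit_amp p0 p"
    if "k \<ge> K0" "p \<in> edge_ends" for k p
    unfolding secular_def[symmetric] by (subst secular_expand) (use Y that in auto)
  have unit_sum: "(\<Sum>p\<in>edge_ends. unit_amp p0 p * f p) = f p0" for f
  proof -
    have "(\<Sum>p\<in>edge_ends. unit_amp p0 p * f p) = (\<Sum>p\<in>edge_ends. if p = p0 then f p else 0)"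
      by (intro sum.cong refl) (simp add: unit_amp_def)
    then show ?thesis using p0 by simp
  qed
  have diff: "h m - h k = (m\<^sup>2 - k\<^sup>2) * J k m" if "k \<ge> K0" "m \<ge> K0" for k m
  proof -
    have "(m\<^sup>2 - k\<^sup>2) * J k m = (\<Sum>p\<in>edge_ends. end_value k (Y k) p * end_slope m (Y m) p - end_slope k (Y k) p * end_value m (Y m) p)"
      unfolding J_def u_def green_graph ..
    also have "\<dots> = (\<Sum>p\<in>edge_ends. unit_amp p0 p * w m p - unit_amp p0 p * w k p)"
      unfolding w_def
      by (rule trans[OF data_symplectic[where \<theta> = \<theta>]], intro sum.cong refl) (use x that in simp)
    also have "\<dots> = h m - h k" unfolding sum_subtractf unit_sum h_def ..
    finally show ?thesis ..
  qed
  have Jcont: "continuous_on {K0..} (J k)" for k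
    unfolding J_def
  proof (intro continuous_on_sum)
    fix e assume e: "e \<in> arcs G"
    have "continuous_on ({K0..} \<times> cbox 0 (l e)) (\<lambda>(m, x). u k e x * u m e x)"
      unfolding u_def split_beta
      by (intro continuous_on_mult wave_continuous continuous_on_compose2[OF Ycont] continuous_intros)
         (use e in \<open>auto simp: edge_ends_def\<close>)
    from integral_continuous_on_param[OF this]
    show "continuous_on {K0..} (\<lambda>m. integral {0..l e} (\<lambda>x. u k e x * u m e x))" by simp
  qed
  have deriv: "(h has_real_derivative 2 * k * J k k) (at k)" if k: "k > K0" for k
    unfolding has_field_derivative_iff
  proof (rule Lim_transform_eventually)
    have "isCont (J k) k"
      using Jcont continuous_on_interior[of "{K0..}" "J k" k] k by simp
    then have "((\<lambda>m. (m + k) * J k m) \<longlongrightarrow> (k + k) * J k k) (at k)"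
      unfolding isCont_def by (intro tendsto_intros)
    then show "((\<lambda>m. (m + k) * J k m) \<longlongrightarrow> 2 * k * J k k) (at k)" by simp
    have ne: "\<forall>\<^sub>F m in at k. m \<noteq> k" by (rule eventually_neq_at_within)
    have "\<forall>\<^sub>F m in at k. m > K0" using k by (intro order_tendstoD) auto
    then show "\<forall>\<^sub>F m in at k. (m + k) * J k m = (h m - h k) / (m - k)"
      using ne
    proof eventually_elim
      case (elim m)
      have "h m - h k = ((m - k) * (m + k)) * J k m"
        using diff[of k m] elim k by (simp add: power2_eq_square algebra_simps)
      then show ?case using elim by (simp add: field_simps)
    qed
  qed
  define c where "c = Min (l ` arcs G) / 4"
  have c: "c > 0" using arcs_nonempty length_pos by (simp add: c_def)
  have cl: "c \<le> l e / 4" if "e \<in> arcs G" for e using that by (simp add: c_def)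
  have riccati: "c / k * (1 + (h k)\<^sup>2) \<le> 2 * k * J k k" if k: "k \<ge> K0" for k
  proof -
    have k1: "k \<ge> 1" using k K0 by simp
    have "1 + (h k)\<^sup>2 \<le> (\<Sum>p\<in>edge_ends. (unit_amp p0 p)\<^sup>2 + (w k p)\<^sup>2)"
      using member_le_sum[OF p0, of "\<lambda>p. (unit_amp p0 p)\<^sup>2 + (w k p)\<^sup>2"] by (simp add: h_def unit_amp_def)
    also have "\<dots> = (\<Sum>p\<in>edge_ends. (end_value k (Y k) p)\<^sup>2 + (end_slope k (Y k) p)\<^sup>2)"
      unfolding w_def
      by (rule sym, rule trans[OF data_isometric[where \<theta> = \<theta>]], intro sum.cong refl) (use x k in simp)
    also have "\<dots> \<le> (\<Sum>e\<in>arcs G. 2 * k\<^sup>2 * ((Y k (e, False))\<^sup>2 + (Y k (e, True))\<^sup>2))"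
      unfolding sum_edge_ends
    proof (rule sum_mono)
      fix e
      show "(end_value k (Y k) (e, False))\<^sup>2 + (end_slope k (Y k) (e, False))\<^sup>2 +
         ((end_value k (Y k) (e, True))\<^sup>2 + (end_slope k (Y k) (e, True))\<^sup>2) \<le> 2 * k\<^sup>2 * ((Y k (e, False))\<^sup>2 + (Y k (e, True))\<^sup>2)"
        using end_data_bound[OF k1, of "Y k" e False] end_data_bound[OF k1, of "Y k" e True] by linarith
    qed
    finally have 1: "1 + (h k)\<^sup>2 \<le> 2 * k\<^sup>2 * (\<Sum>e\<in>arcs G. (Y k (e, False))\<^sup>2 + (Y k (e, True))\<^sup>2)"
      by (simp add: sum_distrib_left)
    have "c * (\<Sum>e\<in>arcs G. (Y k (e, False))\<^sup>2 + (Y k (e, True))\<^sup>2) \<le> J k k"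
      unfolding J_def sum_distrib_left
    proof (rule sum_mono)
      fix e assume e: "e \<in> arcs G"
      have "c * ((Y k (e, False))\<^sup>2 + (Y k (e, True))\<^sup>2) \<le> l e / 4 * ((Y k (e, False))\<^sup>2 + (Y k (e, True))\<^sup>2)"
        using cl[OF e] by (intro mult_right_mono) auto
      also have "\<dots> \<le> integral {0..l e} (\<lambda>x. u k e x * u k e x)"
        unfolding u_def using K1[OF _ e, of k "Y k"] k K0 by simp
      finally show "c * ((Y k (e, False))\<^sup>2 + (Y k (e, True))\<^sup>2) \<le> integral {0..l e} (\<lambda>x. u k e x * u k e x)" .
    qed
    note lower = mult_left_mono[OF this, of "2 * k\<^sup>2"]
    have "c * (1 + (h k)\<^sup>2) \<le> c * (2 * k\<^sup>2 * (\<Sum>e\<in>arcs G. (Y k (e, False))\<^sup>2 + (Y k (e, True))\<^sup>2))"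
      using 1 c by (intro mult_left_mono) auto
    also have "\<dots> = 2 * k\<^sup>2 * (c * (\<Sum>e\<in>arcs G. (Y k (e, False))\<^sup>2 + (Y k (e, True))\<^sup>2))"
      by (rule mult.left_commute)
    also have "\<dots> \<le> 2 * k\<^sup>2 * J k k" by (rule lower) simp
    finally have "c * (1 + (h k)\<^sup>2) \<le> 2 * k\<^sup>2 * J k k" .
    then show ?thesis using k1 by (simp add: field_simps power2_eq_square)
  qed
  (* Over an interval on which c * ln k increases by 4, arctan h would have to increase by more than pi. *)
  define a where "a = K0 + 1"
  define b where "b = a * exp (4 / c)"
  have ab: "K0 < a" "0 < a" "a \<le> b"
    using K0 c by (auto simp: a_def b_def mult_le_cancel_left1)
  have "arctan (h a) - c * ln a \<le> arctan (h b) - c * ln b"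
  proof (rule DERIV_nonneg_imp_nondecreasing[OF ab(3)])
    fix k assume "a \<le> k" "k \<le> b"
    then have k: "K0 < k" "0 < k" using ab by auto
    have "((\<lambda>k. arctan (h k) - c * ln k) has_real_derivative
            inverse (1 + (h k)\<^sup>2) * (2 * k * J k k) - c * (1 / k)) (at k)"
      using k by (auto intro!: derivative_eq_intros deriv)
    moreover have "inverse (1 + (h k)\<^sup>2) * (2 * k * J k k) - c * (1 / k) \<ge> 0"
    proof -
      have pos: "1 + (h k)\<^sup>2 > 0" by (simp add: add_pos_nonneg)
      have "c / k = inverse (1 + (h k)\<^sup>2) * (c / k * (1 + (h k)\<^sup>2))" using pos by simp
      also have "\<dots> \<le> inverse (1 + (h k)\<^sup>2) * (2 * k * J k k)"
        using riccati[of k] k pos by (intro mult_left_mono) auto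
      finally show ?thesis by simp
    qed
    ultimately show "\<exists>d. ((\<lambda>k. arctan (h k) - c * ln k) has_real_derivative d) (at k) \<and> 0 \<le> d" by blast
  qed
  moreover have "c * ln b = c * ln a + 4" using ab c by (simp add: b_def ln_mult algebra_simps)
  ultimately have "4 \<le> arctan (h b) - arctan (h a)" by simp
  then show False
    using arctan_bounded[of "h a"] arctan_bounded[of "h b"] pi_less_4 by linarith
qed

end

section \<open>Eigenfunctions on an edge and their intensities\<close>

definition trigonometric_on :: "real \<Rightarrow> real \<Rightarrow> (real \<Rightarrow> complex) \<Rightarrow> bool" where
  "trigonometric_on L k f \<longleftrightarrow>
     (\<exists>A B. \<forall>x\<in>{0..L}. f x = A * complex_of_real (cos (k * x)) + B * complex_of_real (sin (k * x)))"

lemma edge_deriv_eq: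
  assumes "L > 0" "x \<in> {0..L}" "(f has_vector_derivative D) (at x within {0..L})"
  shows "edge_deriv L f x = D"
  unfolding edge_deriv_def using assms by (intro vector_derivative_within_closed_interval) auto

text \<open>
  The integral form of the equation makes the derivative \<open>g\<close> of \<open>f\<close> differentiable. Undoing the
  rotation of \<open>(f, g / k)\<close> by the angle \<open>k * x\<close> then gives two functions with zero derivative, which
  are the amplitudes.
\<close>
lemma H2_eigenfunction_trigonometric:
  fixes f :: "real \<Rightarrow> complex"
  assumes L: "L > 0" and k: "k > 0"
    and H2: "H2_second_deriv L f (\<lambda>x. - (complex_of_real (k\<^sup>2) * f x))"
  shows "trigonometric_on L k f"
proof -
  define g where "g = edge_deriv L f"
  have df: "(f has_vector_derivative g x) (at x within {0..L})" if "x \<in> {0..L}" for x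
    using H2 that unfolding H2_second_deriv_def g_def edge_deriv_def vector_derivative_works[symmetric]
    by blast
  have cf: "continuous_on {0..L} f"
    using df by (rule continuous_on_vector_derivative)
  have cf2: "continuous_on {0..L} (\<lambda>x. - (complex_of_real (k\<^sup>2) * f x))"
    by (intro continuous_intros cf)
  have g: "g x = g 0 + integral {0..x} (\<lambda>x. - (complex_of_real (k\<^sup>2) * f x))" if "x \<in> {0..L}" for x
  proof -
    have "(LINT t:{0..x}|lebesgue. - (complex_of_real (k\<^sup>2) * f t)) = integral {0..x} (\<lambda>x. - (complex_of_real (k\<^sup>2) * f x))"
      using that
      by (intro set_lebesgue_integral_eq_integral absolutely_integrable_continuous_real
          continuous_on_subset[OF cf2]) auto
    then show ?thesis using H2 that unfolding H2_second_deriv_def g_def by metis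
  qed
  have dg: "(g has_vector_derivative - (complex_of_real (k\<^sup>2) * f x)) (at x within {0..L})" if x: "x \<in> {0..L}" for x
  proof (rule has_vector_derivative_transform[OF x g])
    show "((\<lambda>x. g 0 + integral {0..x} (\<lambda>x. - (complex_of_real (k\<^sup>2) * f x)))
        has_vector_derivative - (complex_of_real (k\<^sup>2) * f x)) (at x within {0..L})"
      using has_vector_derivative_add[OF has_vector_derivative_const[of "g 0"] integral_has_vector_derivative[OF cf2 x]]
      by (simp only: add_0)
  qed
  let ?c = "\<lambda>x. complex_of_real (cos (k * x))" and ?s = "\<lambda>x. complex_of_real (sin (k * x))"
  have dc: "(?c has_vector_derivative - (complex_of_real k * ?s x)) (at x within {0..L})" for x
  proof -
    have "((\<lambda>x. cos (k * x)) has_real_derivative - (k * sin (k * x))) (at x within {0..L})"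
      by (auto intro!: derivative_eq_intros)
    then show ?thesis
      using bounded_linear.has_vector_derivative[OF bounded_linear_of_real[where 'a=complex]]
      unfolding has_real_derivative_iff_has_vector_derivative by fastforce
  qed
  have ds: "(?s has_vector_derivative complex_of_real k * ?c x) (at x within {0..L})" for x
  proof -
    have "((\<lambda>x. sin (k * x)) has_real_derivative k * cos (k * x)) (at x within {0..L})"
      by (auto intro!: derivative_eq_intros)
    then show ?thesis
      using bounded_linear.has_vector_derivative[OF bounded_linear_of_real[where 'a=complex]]
      unfolding has_real_derivative_iff_has_vector_derivative by fastforce
  qed
  have "((\<lambda>x. f x * ?c x - g x * ?s x / k) has_vector_derivative 0) (at x within {0..L})" if x: "x \<in> {0..L}" for x
    using k by (auto intro!: derivative_eq_intros df[OF x] dg[OF x] dc ds simp: field_simps power2_eq_square)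
  then obtain A where A: "\<And>x. x \<in> {0..L} \<Longrightarrow> f x * ?c x - g x * ?s x / k = A"
    using has_vector_derivative_zero_constant[of "{0..L}" "\<lambda>x. f x * ?c x - g x * ?s x / k"] by auto
  have "((\<lambda>x. f x * ?s x + g x * ?c x / k) has_vector_derivative 0) (at x within {0..L})" if x: "x \<in> {0..L}" for x
    using k by (auto intro!: derivative_eq_intros df[OF x] dg[OF x] dc ds simp: field_simps power2_eq_square)
  then obtain B where B: "\<And>x. x \<in> {0..L} \<Longrightarrow> f x * ?s x + g x * ?c x / k = B"
    using has_vector_derivative_zero_constant[of "{0..L}" "\<lambda>x. f x * ?s x + g x * ?c x / k"] by auto
  show ?thesis
    unfolding trigonometric_on_def
  proof (intro exI ballI)
    fix x assume x: "x \<in> {0..L}"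
    have one: "?c x * ?c x + ?s x * ?s x = 1"
      by (metis of_real_1 of_real_add of_real_mult power2_eq_square sin_cos_squared_add2)
    have "A * ?c x + B * ?s x = f x * (?c x * ?c x + ?s x * ?s x)"
      unfolding A[OF x, symmetric] B[OF x, symmetric] by (simp add: algebra_simps)
    then show "f x = A * ?c x + B * ?s x" using one by simp
  qed
qed

text \<open>
  The amplitudes are determined by \<open>f\<close>: the first is the value at 0, the second is the value at any
  point where the sine does not vanish.
\<close>
lemma edge_intensity_eq:
  assumes L: "L > 0" and k: "k > 0"
    and f: "\<And>x. x \<in> {0..L} \<Longrightarrow> f x = A * complex_of_real (cos (k * x)) + B * complex_of_real (sin (k * x))"
  shows "edge_intensity L k f = ((cmod A)\<^sup>2 + (cmod B)\<^sup>2) / 2"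
  unfolding edge_intensity_def
proof (rule the_equality)
  fix r assume "\<exists>A B. (\<forall>x\<in>{0..L}. f x = A * complex_of_real (cos (k * x)) + B * complex_of_real (sin (k * x)))
     \<and> r = ((cmod A)\<^sup>2 + (cmod B)\<^sup>2) / 2"
  then obtain A' B' where AB': "\<And>x. x \<in> {0..L} \<Longrightarrow> f x = A' * complex_of_real (cos (k * x)) + B' * complex_of_real (sin (k * x))"
    and r: "r = ((cmod A')\<^sup>2 + (cmod B')\<^sup>2) / 2" by blast
  have A: "A' = A" using f[of 0] AB'[of 0] L by simp
  define x where "x = min L (pi / (2 * k))"
  have "k * x \<le> k * (pi / (2 * k))" using k by (intro mult_left_mono) (auto simp: x_def)
  then have "k * x \<le> pi / 2" using k by simp
  then have lt: "k * x < pi" using pi_gt_zero by linarith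
  have "x > 0" "x \<le> L" using L k by (auto simp: x_def)
  then have x: "x \<in> {0..L}" "0 < k * x" "k * x < pi" using k lt by auto
  have "sin (k * x) \<noteq> 0" using sin_gt_zero[OF x(2,3)] by simp
  then have "B' = B" using f[OF x(1)] AB'[OF x(1)] A by simp
  with A r show "r = ((cmod A)\<^sup>2 + (cmod B)\<^sup>2) / 2" by simp
qed (use f in blast)

lemma edge_intensity_nonneg:
  "L > 0 \<Longrightarrow> k > 0 \<Longrightarrow> trigonometric_on L k f \<Longrightarrow> edge_intensity L k f \<ge> 0"
proof -
  assume L: "L > 0" and k: "k > 0" and "trigonometric_on L k f"
  then obtain A B where "\<And>x. x \<in> {0..L} \<Longrightarrow> f x = A * complex_of_real (cos (k * x)) + B * complex_of_real (sin (k * x))"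
    unfolding trigonometric_on_def by blast
  from edge_intensity_eq[OF L k this] show "edge_intensity L k f \<ge> 0" by (simp only:) simp
qed

lemma edge_mass_asymptotics:
  assumes S: "S \<in> sets lebesgue" "S \<subseteq> {0..L}" and L: "L > 0" and \<epsilon>: "\<epsilon> > 0"
  shows "\<forall>\<^sub>F k in at_top. \<forall>f. trigonometric_on L k f \<longrightarrow>
     \<bar>(LINT x:S|lebesgue. (cmod (f x))\<^sup>2) - measure lebesgue S * edge_intensity L k f\<bar> \<le> \<epsilon> * edge_intensity L k f"
  using quadratic_mass[OF S \<epsilon>] eventually_gt_at_top[of 0]
proof eventually_elim
  case (elim k)
  show ?case
  proof (intro allI impI)
    fix f assume "trigonometric_on L k f"
    then obtain A B where f: "\<And>x. x \<in> {0..L} \<Longrightarrow> f x = A * complex_of_real (cos (k * x)) + B * complex_of_real (sin (k * x))"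
      unfolding trigonometric_on_def by blast
    let ?w = "\<lambda>x. (cmod A)\<^sup>2 * (cos (k * x))\<^sup>2 + (cmod B)\<^sup>2 * (sin (k * x))\<^sup>2
        + 2 * Re (A * cnj B) * (cos (k * x) * sin (k * x))"
    have q: "edge_intensity L k f = ((cmod A)\<^sup>2 + (cmod B)\<^sup>2) / 2"
      using L elim f by (intro edge_intensity_eq) auto
    have "(LINT x:S|lebesgue. (cmod (f x))\<^sup>2) = (LINT x:S|lebesgue. ?w x)"
    proof (rule set_lebesgue_integral_cong)
      show "\<forall>x. x \<in> S \<longrightarrow> (cmod (f x))\<^sup>2 = ?w x"
      proof (intro allI impI)
        fix x assume "x \<in> S"
        then have fx: "f x = A * complex_of_real (cos (k * x)) + B * complex_of_real (sin (k * x))" using f S by blast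
        show "(cmod (f x))\<^sup>2 = ?w x"
          unfolding fx cmod_power2 by (simp add: power2_eq_square algebra_simps)
      qed
    qed (rule S)
    moreover have "\<bar>Re (A * cnj B)\<bar> \<le> ((cmod A)\<^sup>2 + (cmod B)\<^sup>2) / 2"
    proof -
      have "\<bar>Re (A * cnj B)\<bar> \<le> cmod A * cmod B"
        using abs_Re_le_cmod[of "A * cnj B"] by (simp add: norm_mult)
      then show ?thesis using sum_squares_bound[of "cmod A" "cmod B"] by simp
    qed
    ultimately show "\<bar>(LINT x:S|lebesgue. (cmod (f x))\<^sup>2) - measure lebesgue S * edge_intensity L k f\<bar>
        \<le> \<epsilon> * edge_intensity L k f"
      unfolding q using elim(1)[rule_format, of "Re (A * cnj B)" "(cmod A)\<^sup>2" "(cmod B)\<^sup>2"] by simp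
  qed
qed

context metric_graph begin

lemma eigenfunction_waves:
  assumes "k > 0" "normalized_eigenfunction G l M (k\<^sup>2) u" "e \<in> arcs G"
  shows "trigonometric_on (l e) k (u e)"
proof -
  have "H2_second_deriv (l e) (u e) (\<lambda>x. - (complex_of_real (k\<^sup>2) * u e x))"
    using assms unfolding normalized_eigenfunction_def neg_laplacian_def by blast
  then show ?thesis by (rule H2_eigenfunction_trigonometric[OF length_pos[OF assms(3)] assms(1)])
qed

lemma eigenfunction_mass_asymptotics:
  assumes \<omega>: "measurable_subset G l \<omega>" and \<epsilon>: "\<epsilon> > 0"
  shows "\<forall>\<^sub>F k in at_top. \<forall>e\<in>arcs G. \<forall>u. normalized_eigenfunction G l M (k\<^sup>2) u \<longrightarrow>
     \<bar>(LINT x:\<omega> e|lebesgue. (cmod (u e x))\<^sup>2) - measure lebesgue (\<omega> e) * edge_intensity (l e) k (u e)\<bar>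
       \<le> \<epsilon> * edge_intensity (l e) k (u e)"
proof (rule eventually_ball_finite[OF finite_arcs], rule ballI)
  fix e assume e: "e \<in> arcs G"
  have S: "\<omega> e \<in> sets lebesgue" "\<omega> e \<subseteq> {0..l e}" using \<omega> e by (auto simp: measurable_subset_def)
  show "\<forall>\<^sub>F k in at_top. \<forall>u. normalized_eigenfunction G l M (k\<^sup>2) u \<longrightarrow>
     \<bar>(LINT x:\<omega> e|lebesgue. (cmod (u e x))\<^sup>2) - measure lebesgue (\<omega> e) * edge_intensity (l e) k (u e)\<bar>
       \<le> \<epsilon> * edge_intensity (l e) k (u e)"
    using edge_mass_asymptotics[OF S length_pos[OF e] \<epsilon>] eventually_gt_at_top[of 0]
  proof eventually_elim
    case (elim k)
    then show ?case using eigenfunction_waves[OF _ _ e] by blast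
  qed
qed

text \<open>
  On a full edge the mass is close to its length times the intensity, and the mass is at most 1.
\<close>
lemma eigenfunction_intensity_bounded:
  "\<forall>\<^sub>F k in at_top. \<forall>e\<in>arcs G. \<forall>u. normalized_eigenfunction G l M (k\<^sup>2) u \<longrightarrow>
     edge_intensity (l e) k (u e) \<in> {0..2 / Min (l ` arcs G)}"
proof -
  define lmin where "lmin = Min (l ` arcs G)"
  have lmin: "lmin > 0" "\<And>e. e \<in> arcs G \<Longrightarrow> lmin \<le> l e"
    using arcs_nonempty length_pos by (auto simp: lmin_def)
  have "measurable_subset G l (\<lambda>e. {0..l e})" by (simp add: measurable_subset_def)
  from eigenfunction_mass_asymptotics[OF this, of "lmin / 2"] lmin
  have "\<forall>\<^sub>F k in at_top. \<forall>e\<in>arcs G. \<forall>u. normalized_eigenfunction G l M (k\<^sup>2) u \<longrightarrow>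
     \<bar>(LINT x:{0..l e}|lebesgue. (cmod (u e x))\<^sup>2) - measure lebesgue {0..l e} * edge_intensity (l e) k (u e)\<bar>
       \<le> lmin / 2 * edge_intensity (l e) k (u e)" by simp
  then show ?thesis
    using eventually_gt_at_top[of 0]
  proof eventually_elim
    case (elim k)
    show ?case
    proof (intro ballI allI impI)
      fix e u assume e: "e \<in> arcs G" and u: "normalized_eigenfunction G l M (k\<^sup>2) u"
      let ?q = "edge_intensity (l e) k (u e)" and ?m = "\<lambda>e. LINT x:{0..l e}|lebesgue. (cmod (u e x))\<^sup>2"
      have q0: "?q \<ge> 0"
        by (rule edge_intensity_nonneg[OF length_pos[OF e] elim(2) eigenfunction_waves[OF elim(2) u e]])
      have m0: "?m e \<ge> 0" for e
        by (simp add: set_lebesgue_integral_def)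
      have "sqrt (\<Sum>e\<in>arcs G. ?m e) = 1"
        using u by (simp add: normalized_eigenfunction_def L2_norm_def L2_mass_def)
      then have "(\<Sum>e\<in>arcs G. ?m e) = 1" by simp
      then have "?m e \<le> 1" using member_le_sum[of e "arcs G" ?m] e m0 by simp
      moreover have "\<bar>?m e - l e * ?q\<bar> \<le> lmin / 2 * ?q"
        using elim(1)[rule_format, OF e u] length_pos[OF e] by simp
      ultimately have "l e * ?q - lmin / 2 * ?q \<le> 1" by linarith
      moreover have "lmin * ?q \<le> l e * ?q" using lmin(2)[OF e] q0 by (intro mult_right_mono) auto
      ultimately have "lmin * ?q \<le> 2" by linarith
      then have "?q \<le> 2 / lmin" using lmin(1) by (simp add: field_simps)
      then show "?q \<in> {0..2 / Min (l ` arcs G)}" using q0 unfolding lmin_def by simp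
    qed
  qed
qed

end

section \<open>Eigenfunctions of arbitrarily high frequency\<close>

context metric_graph begin

lemma secular_scale:
  "secular \<theta> k (\<lambda>q. c * y q) p = c * secular \<theta> k y p"
proof -
  have "end_value k (\<lambda>q. c * y q) = (\<lambda>p. c * end_value k y p)"
    "end_slope k (\<lambda>q. c * y q) = (\<lambda>p. c * end_slope k y p)"
    by (auto simp: end_value_def end_slope_def wave_def wave_deriv_def algebra_simps)
  then show ?thesis
    unfolding secular_def cos_data_def by (simp add: vertex_avg_cmult algebra_simps)
qed

definition wave_fun :: "real \<Rightarrow> ('e \<times> bool \<Rightarrow> real) \<Rightarrow> 'e graph_fun" where
  "wave_fun k y e x = complex_of_real (wave k y e x)"

lemma wave_fun_has_derivative:
  "(wave_fun k y e has_vector_derivative complex_of_real (wave_deriv k y e x)) (at x within X)"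
  "((\<lambda>x. complex_of_real (wave_deriv k y e x)) has_vector_derivative
      - (complex_of_real (k\<^sup>2) * wave_fun k y e x)) (at x within X)"
proof -
  note of_real = bounded_linear.has_vector_derivative[OF bounded_linear_of_real[where 'a=complex]]
  note der = wave_has_derivative[unfolded has_real_derivative_iff_has_vector_derivative]
  show "(wave_fun k y e has_vector_derivative complex_of_real (wave_deriv k y e x)) (at x within X)"
    using of_real[OF der(1)] unfolding wave_fun_def[abs_def] .
  show "((\<lambda>x. complex_of_real (wave_deriv k y e x)) has_vector_derivative
      - (complex_of_real (k\<^sup>2) * wave_fun k y e x)) (at x within X)"
    using of_real[OF der(2), of k y e x X] unfolding wave_fun_def[abs_def] by simp
qed

lemma wave_fun_continuous: "continuous_on X (wave_fun k y e)"
  using continuous_on_vector_derivative[OF wave_fun_has_derivative(1)] .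

lemma edge_deriv_wave_fun:
  assumes "e \<in> arcs G" "x \<in> {0..l e}"
  shows "edge_deriv (l e) (wave_fun k y e) x = complex_of_real (wave_deriv k y e x)"
  by (rule edge_deriv_eq[OF length_pos[OF assms(1)] assms(2) wave_fun_has_derivative(1)])

lemma wave_fun_H2:
  assumes e: "e \<in> arcs G"
  shows "H2_second_deriv (l e) (wave_fun k y e) (\<lambda>x. - (complex_of_real (k\<^sup>2) * wave_fun k y e x))"
  unfolding H2_second_deriv_def
proof (intro conjI ballI)
  let ?g = "\<lambda>x. - (complex_of_real (k\<^sup>2) * wave_fun k y e x)"
  have cg: "continuous_on X ?g" for X by (intro continuous_intros wave_fun_continuous)
  have int: "?g absolutely_integrable_on {0..x}" for x
    by (rule absolutely_integrable_continuous_real[OF cg])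
  show "wave_fun k y e differentiable at x within {0..l e}" for x
    using wave_fun_has_derivative(1) by (rule differentiableI_vector)
  show "set_borel_measurable lebesgue {0..l e} ?g"
    using int[of "l e"] unfolding set_integrable_def set_borel_measurable_def by (rule borel_measurable_integrable)
  show "set_integrable lebesgue {0..l e} (\<lambda>x. (cmod (?g x))\<^sup>2)"
    by (intro absolutely_integrable_continuous_real continuous_intros cg)
  fix x assume x: "x \<in> {0..l e}"
  have "(?g has_integral complex_of_real (wave_deriv k y e x) - complex_of_real (wave_deriv k y e 0)) {0..x}"
    using x by (intro fundamental_theorem_of_calculus wave_fun_has_derivative) auto
  then have "(LINT t:{0..x}|lebesgue. ?g t) = complex_of_real (wave_deriv k y e x) - complex_of_real (wave_deriv k y e 0)"
    using set_lebesgue_integral_eq_integral(2)[OF int] by (metis integral_unique)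
  moreover have "0 \<in> {0..l e}" using length_pos[OF e] by simp
  ultimately show "edge_deriv (l e) (wave_fun k y e) x
      = edge_deriv (l e) (wave_fun k y e) 0 + (LINT t:{0..x}|lebesgue. ?g t)"
    using x by (simp only: edge_deriv_wave_fun[OF e] add_diff_eq add_diff_cancel_left')
qed

lemma wave_fun_end_data:
  assumes "e \<in> arcs G"
  shows "wave_fun k y e 0 = complex_of_real (end_value k y (e, False))"
    and "wave_fun k y e (l e) = complex_of_real (end_value k y (e, True))"
    and "edge_deriv (l e) (wave_fun k y e) 0 = complex_of_real (end_slope k y (e, False))"
    and "- edge_deriv (l e) (wave_fun k y e) (l e) = complex_of_real (end_slope k y (e, True))"
  using edge_deriv_wave_fun[OF assms, of 0 k y] edge_deriv_wave_fun[OF assms, of "l e" k y] length_pos[OF assms]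
  by (auto simp: wave_fun_def end_value_def end_slope_def)

lemma ends_at_eq:
  "ends_at v = (\<lambda>e. (e, False)) ` out_arcs G v \<union> (\<lambda>e. (e, True)) ` in_arcs G v"
proof -
  have "p \<in> ends_at v \<longleftrightarrow> p \<in> (\<lambda>e. (e, False)) ` out_arcs G v \<union> (\<lambda>e. (e, True)) ` in_arcs G v" for p
    by (cases p; cases "snd p") (auto simp: ends_at_def edge_ends_def vertex_at_def)
  then show ?thesis by blast
qed

lemma finite_in_out [simp]: "finite (out_arcs G v)" "finite (in_arcs G v)"
  using finite_arcs by (auto simp: out_arcs_def in_arcs_def)

lemma sum_ends_at:
  "(\<Sum>p\<in>ends_at v. F p) = (\<Sum>e\<in>out_arcs G v. F (e, False)) + (\<Sum>e\<in>in_arcs G v. F (e, True))"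
  for F :: "'e \<times> bool \<Rightarrow> 'x::comm_monoid_add"
  unfolding ends_at_eq by (subst sum.union_disjoint) (auto simp: sum.reindex inj_on_def)

lemma card_ends_at: "card (ends_at v) = in_degree G v + out_degree G v"
  using sum_ends_at[where v = v and F = "\<lambda>_. 1::nat"] by (simp add: in_degree_def out_degree_def)

text \<open>
  Averaging the equations over the ends at \<open>v\<close> isolates the sum of the slopes; what is left says that
  every value at \<open>v\<close> equals their average.
\<close>
lemma secular_kirchhoff:
  assumes \<theta>: "\<theta> v = pi / 2" and z: "\<And>p. p \<in> edge_ends \<Longrightarrow> secular \<theta> k y p = 0"
  shows "kirchhoff_condition G l (wave_fun k y) v"
proof -
  have cs: "cos (\<theta> v) = 0" "sin (\<theta> v) = 1" by (simp_all only: \<theta> cos_pi_half sin_pi_half)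
  have eq: "end_value k y p - vertex_avg (end_value k y) v + vertex_avg (end_slope k y) v = 0"
    if "p \<in> ends_at v" for p
    using z[of p] that by (simp add: cs ends_at_def secular_def cos_data_def)
  have "(\<Sum>p\<in>ends_at v. end_slope k y p) = 0"
  proof (cases "ends_at v = {}")
    case False
    then obtain p where p: "p \<in> edge_ends" "vertex_at p = v" by (auto simp: ends_at_def)
    have "vertex_avg (cos_data \<theta> (end_value k y) (end_slope k y)) v = 0"
      using z by (intro vertex_avg_const[OF False]) (auto simp: ends_at_def secular_def)
    then have "vertex_avg (end_slope k y) v = 0"
      using vertex_avg_data(1)[OF p(1), of v \<theta>] p(2) cs by simp
    then show ?thesis using False by (simp add: vertex_avg_def)
  qed simp
  note slope = this
  have val: "end_value k y p = vertex_avg (end_value k y) v" if "p \<in> ends_at v" for p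
    using eq[OF that] slope by (simp add: vertex_avg_def)
  have out: "e \<in> arcs G" "(e, False) \<in> ends_at v" if "e \<in> out_arcs G v" for e
    using that unfolding ends_at_eq by auto
  have inn: "e \<in> arcs G" "(e, True) \<in> ends_at v" if "e \<in> in_arcs G v" for e
    using that unfolding ends_at_eq by auto
  have "(\<Sum>e\<in>out_arcs G v. edge_deriv (l e) (wave_fun k y e) 0) +
     (\<Sum>e\<in>in_arcs G v. - edge_deriv (l e) (wave_fun k y e) (l e)) = complex_of_real (\<Sum>p\<in>ends_at v. end_slope k y p)"
    unfolding sum_ends_at of_real_add of_real_sum
    by (intro arg_cong2[where f="(+)"] sum.cong refl wave_fun_end_data out inn)
  moreover have "\<exists>c. (\<forall>e\<in>out_arcs G v. wave_fun k y e 0 = c) \<and> (\<forall>e\<in>in_arcs G v. wave_fun k y e (l e) = c)"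
    using val out inn by (intro exI[of _ "complex_of_real (vertex_avg (end_value k y) v)"]) (simp add: wave_fun_end_data)
  ultimately show ?thesis unfolding kirchhoff_condition_def using slope by simp
qed

lemma secular_exterior:
  assumes v: "v \<in> exterior_verts G"
    and M: "M = {(a, b). complex_of_real (cos (\<theta> v)) * a + complex_of_real (sin (\<theta> v)) * b = 0}"
    and z: "\<And>p. p \<in> edge_ends \<Longrightarrow> secular \<theta> k y p = 0"
  shows "exterior_condition G l M (wave_fun k y) v"
proof -
  have "card (ends_at v) = 1" using v by (simp add: exterior_verts_def card_ends_at)
  then obtain p0 where p0: "ends_at v = {p0}" by (auto simp: card_1_singleton_iff)
  then have "p0 \<in> edge_ends" "vertex_at p0 = v" by (auto simp: ends_at_def)
  then have "cos (\<theta> v) * end_value k y p0 + sin (\<theta> v) * end_slope k y p0 = 0"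
    using z[of p0] by (simp add: secular_def cos_data_def vertex_avg_def p0)
  then have eq: "(complex_of_real (end_value k y p), complex_of_real (end_slope k y p)) \<in> M"
    if "p \<in> ends_at v" for p
    using that unfolding p0 M by (simp flip: of_real_mult of_real_add)
  show ?thesis
    unfolding exterior_condition_def
  proof (intro conjI ballI)
    fix e assume "e \<in> out_arcs G v"
    then have "e \<in> arcs G" "(e, False) \<in> ends_at v" unfolding ends_at_eq by auto
    then show "(wave_fun k y e 0, edge_deriv (l e) (wave_fun k y e) 0) \<in> M"
      using eq by (simp add: wave_fun_end_data)
  next
    fix e assume "e \<in> in_arcs G v"
    then have "e \<in> arcs G" "(e, True) \<in> ends_at v" unfolding ends_at_eq by auto
    then show "(wave_fun k y e (l e), - edge_deriv (l e) (wave_fun k y e) (l e)) \<in> M"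
      using eq by (simp only: wave_fun_end_data)
  qed
qed

text \<open>
  Each self-adjoint exterior condition is given by an angle, and Kirchhoff conditions have the angle
  \<open>pi / 2\<close>, so that a nontrivial solution of the secular system is an eigenfunction. It can be
  normalized because the energy of a wave with nonzero amplitudes is positive for large \<open>k\<close>.
\<close>
lemma normalized_eigenfunction_exists:
  assumes M: "\<And>v. v \<in> exterior_verts G \<Longrightarrow> selfadjoint_condition (M v)"
  obtains k u where "k \<ge> K" "normalized_eigenfunction G l M (k\<^sup>2) u"
proof -
  have "\<forall>v. \<exists>t. v \<in> exterior_verts G \<longrightarrow>
      M v = {(a, b). complex_of_real (cos t) * a + complex_of_real (sin t) * b = 0}"
    using M unfolding selfadjoint_condition_iff by blast
  then obtain t where t: "\<And>v. v \<in> exterior_verts G \<Longrightarrow>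
      M v = {(a, b). complex_of_real (cos (t v)) * a + complex_of_real (sin (t v)) * b = 0}"
    by metis
  define \<theta> where "\<theta> v = (if v \<in> exterior_verts G then t v else pi / 2)" for v
  obtain K1 where K1: "\<And>k e y. k \<ge> K1 \<Longrightarrow> e \<in> arcs G \<Longrightarrow>
     l e / 4 * ((y (e, False))\<^sup>2 + (y (e, True))\<^sup>2) \<le> integral {0..l e} (\<lambda>x. wave k y e x * wave k y e x)"
    using wave_energy_lower_bound unfolding eventually_at_top_linorder by blast
  obtain k y where k: "k \<ge> max K K1" and nz: "\<exists>p\<in>edge_ends. y p \<noteq> 0"
    and z: "\<And>p. p \<in> edge_ends \<Longrightarrow> secular \<theta> k y p = 0"
    using secular_frequency_exists[of "max K K1" \<theta>] by metis
  define N where "N = (\<Sum>e\<in>arcs G. integral {0..l e} (\<lambda>x. wave k y e x * wave k y e x))"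
  have N: "N > 0"
  proof -
    have low: "l e / 4 * ((y (e, False))\<^sup>2 + (y (e, True))\<^sup>2) \<le> integral {0..l e} (\<lambda>x. wave k y e x * wave k y e x)"
      if "e \<in> arcs G" for e using K1[OF _ that] k by simp
    have nonneg: "0 \<le> l e / 4 * ((y (e, False))\<^sup>2 + (y (e, True))\<^sup>2)" if "e \<in> arcs G" for e
      using length_pos[OF that] by simp
    obtain e b where e: "e \<in> arcs G" and yb: "y (e, b) \<noteq> 0" using nz by (auto simp: edge_ends_def)
    have "(y (e, False))\<^sup>2 + (y (e, True))\<^sup>2 > 0"
      using yb by (cases b) (auto simp: add_pos_nonneg add_nonneg_pos)
    then have "0 < l e / 4 * ((y (e, False))\<^sup>2 + (y (e, True))\<^sup>2)" using length_pos[OF e] by simp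
    then have "0 < integral {0..l e} (\<lambda>x. wave k y e x * wave k y e x)"
      using low[OF e] by (rule less_le_trans)
    then show ?thesis
      unfolding N_def using order_trans[OF nonneg low] by (rule sum_pos2[OF finite_arcs e])
  qed
  define Y where "Y = (\<lambda>q. 1 / sqrt N * y q)"
  have zY: "secular \<theta> k Y p = 0" if "p \<in> edge_ends" for p
    unfolding Y_def secular_scale using z[OF that] by simp
  have "neg_laplacian G l M (wave_fun k Y) (\<lambda>e x. complex_of_real (k\<^sup>2) * wave_fun k Y e x)"
    unfolding neg_laplacian_def
  proof (intro conjI ballI)
    show "H2_second_deriv (l e) (wave_fun k Y e) (\<lambda>x. - (complex_of_real (k\<^sup>2) * wave_fun k Y e x))"
      if "e \<in> arcs G" for e by (rule wave_fun_H2[OF that])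
    show "kirchhoff_condition G l (wave_fun k Y) v" if "v \<in> interior_verts G" for v
      using that zY by (intro secular_kirchhoff) (auto simp: \<theta>_def interior_verts_def)
    show "exterior_condition G l (M v) (wave_fun k Y) v" if "v \<in> exterior_verts G" for v
      using that zY by (intro secular_exterior[where \<theta>=\<theta>]) (auto simp: \<theta>_def t)
  qed
  moreover have "L2_norm G l (wave_fun k Y) = 1"
  proof -
    have "(LINT x:{0..l e}|lebesgue. (cmod (wave_fun k Y e x))\<^sup>2)
       = integral {0..l e} (\<lambda>x. wave k y e x * wave k y e x) / N" for e
    proof -
      have w: "(cmod (wave_fun k Y e x))\<^sup>2 = wave k y e x * wave k y e x / N" for x
      proof -
        have "wave k Y e x = wave k y e x / sqrt N"
          unfolding Y_def wave_def by (simp add: add_divide_distrib)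
        moreover have "(cmod (wave_fun k Y e x))\<^sup>2 = (wave k Y e x)\<^sup>2" by (simp add: wave_fun_def)
        ultimately show ?thesis using N by (simp add: power_divide flip: power2_eq_square)
      qed
      have "(\<lambda>x. (cmod (wave_fun k Y e x))\<^sup>2) absolutely_integrable_on {0..l e}"
        by (intro absolutely_integrable_continuous_real continuous_intros wave_fun_continuous)
      from set_lebesgue_integral_eq_integral(2)[OF this]
      show ?thesis unfolding w by simp
    qed
    then have "L2_mass G (\<lambda>e. {0..l e}) (wave_fun k Y) = 1"
      unfolding L2_mass_def using N by (simp add: N_def flip: sum_divide_distrib)
    then show ?thesis by (simp add: L2_norm_def)
  qed
  ultimately have "normalized_eigenfunction G l M (k\<^sup>2) (wave_fun k Y)"
    unfolding normalized_eigenfunction_def by blast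
  then show ?thesis using that k by auto
qed

end

section \<open>The localization constant\<close>

lemma finite_family_convergent_subsequence:
  fixes f :: "'i \<Rightarrow> nat \<Rightarrow> real"
  assumes "finite I" "\<And>i n. i \<in> I \<Longrightarrow> f i n \<in> {a..b}"
  shows "\<exists>r q. strict_mono r \<and> (\<forall>i\<in>I. (\<lambda>n. f i (r n)) \<longlonglongrightarrow> q i)"
  using assms
proof (induction I rule: finite_induct)
  case empty
  show ?case by (intro exI[of _ id]) (auto simp: strict_mono_def)
next
  case (insert i I)
  then have "\<exists>r q. strict_mono r \<and> (\<forall>j\<in>I. (\<lambda>n. f j (r n)) \<longlonglongrightarrow> q j)" by blast
  then obtain r q where r: "strict_mono r" and q: "\<And>j. j \<in> I \<Longrightarrow> (\<lambda>n. f j (r n)) \<longlonglongrightarrow> q j"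
    by blast
  have "\<forall>n. f i (r n) \<in> {a..b}" using insert.prems by blast
  with compact_Icc[of a b] obtain L s where s: "strict_mono s" "((\<lambda>n. f i (r n)) \<circ> s) \<longlonglongrightarrow> L"
    unfolding compact_def by metis
  have "(\<lambda>n. f j ((r \<circ> s) n)) \<longlonglongrightarrow> (q(i := L)) j" if "j \<in> insert i I" for j
  proof (cases "j = i")
    case True
    then show ?thesis using s(2) by (simp add: o_def)
  next
    case False
    then show ?thesis using LIMSEQ_subseq_LIMSEQ[OF q s(1), of j] that by (simp add: o_def)
  qed
  then show ?case using strict_mono_o[OF r s(1)] by blast
qed

context metric_graph begin

text \<open>
  This is the homogenization: at high frequency the mass on \<open>\<omega>\<close> sees only the measures of the pieces of
  \<open>\<omega>\<close> and the intensities.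
\<close>
lemma mass_tendsto:
  assumes \<omega>: "measurable_subset G l \<omega>"
    and k: "filterlim k at_top sequentially"
    and u: "\<And>n. normalized_eigenfunction G l M ((k n)\<^sup>2) (u n)"
    and q: "\<And>e. e \<in> arcs G \<Longrightarrow> (\<lambda>n. edge_intensity (l e) (k n) (u n e)) \<longlonglongrightarrow> q e"
  shows "(\<lambda>n. L2_mass G \<omega> (u n)) \<longlonglongrightarrow> edge_dot G (\<lambda>e. measure lebesgue (\<omega> e)) q"
  unfolding L2_mass_def edge_dot_def
proof (rule tendsto_sum)
  fix e assume e: "e \<in> arcs G"
  let ?q = "\<lambda>n. edge_intensity (l e) (k n) (u n e)" and ?m = "\<lambda>n. LINT x:\<omega> e|lebesgue. (cmod (u n e x))\<^sup>2"
  let ?\<alpha> = "measure lebesgue (\<omega> e)"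
  define Q where "Q = 2 / Min (l ` arcs G)"
  have "Min (l ` arcs G) > 0" using arcs_nonempty length_pos by simp
  then have Q: "Q > 0" by (simp add: Q_def)
  have bd: "\<forall>\<^sub>F n in sequentially. ?q n \<in> {0..Q}"
    using eventually_compose_filterlim[OF eigenfunction_intensity_bounded k, of M]
    by eventually_elim (use e u in \<open>auto simp: Q_def\<close>)
  have "(\<lambda>n. ?m n - ?\<alpha> * ?q n) \<longlonglongrightarrow> 0"
  proof (rule tendstoI)
    fix \<epsilon> :: real assume \<epsilon>: "\<epsilon> > 0"
    have "\<epsilon> / (2 * Q) > 0" using \<epsilon> Q by simp
    from eventually_compose_filterlim[OF eigenfunction_mass_asymptotics[OF \<omega> this] k, of M] bd
    show "\<forall>\<^sub>F n in sequentially. dist (?m n - ?\<alpha> * ?q n) 0 < \<epsilon>"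
    proof eventually_elim
      case (elim n)
      have "\<bar>?m n - ?\<alpha> * ?q n\<bar> \<le> \<epsilon> / (2 * Q) * ?q n" using elim(1) e u by blast
      also have "\<dots> \<le> \<epsilon> / (2 * Q) * Q" using elim(2) \<epsilon> Q by (intro mult_left_mono) auto
      also have "\<dots> < \<epsilon>" using \<epsilon> Q by simp
      finally show ?case by simp
    qed
  qed
  from tendsto_add[OF this tendsto_mult_left[OF q[OF e], of ?\<alpha>]]
  show "?m \<longlonglongrightarrow> ?\<alpha> * q e" by simp
qed

lemma L2_mass_nonneg: "L2_mass G \<omega> u \<ge> 0"
  unfolding L2_mass_def by (intro sum_nonneg) (simp add: set_lebesgue_integral_def)

text \<open>
  The infimum over eigenvalues \<open>\<ge> \<Lambda>\<close> is monotone in \<open>\<Lambda>\<close>, so that its limit is its supremum. It is a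
  lower bound for the masses in any sequence that defines an attainable \<open>q\<close>, which gives the
  inequality. For equality, take eigenfunctions that almost realize the infimum and pass to a
  subsequence along which the intensities converge; this uses that eigenfunctions of arbitrarily high
  frequency exist and that their intensities are bounded.
\<close>
lemma localization_constant_attained:
  assumes \<omega>: "measurable_subset G l \<omega>"
    and M: "\<And>v. v \<in> exterior_verts G \<Longrightarrow> selfadjoint_condition (M v)"
  shows "\<exists>q\<in>attainable_set G l M. C_infty G l M \<omega> = edge_dot G (\<lambda>e. measure lebesgue (\<omega> e)) q"
    and "q \<in> attainable_set G l M \<Longrightarrow> C_infty G l M \<omega> \<le> edge_dot G (\<lambda>e. measure lebesgue (\<omega> e)) q"
proof -
  define masses where "masses \<Lambda> = {L2_mass G \<omega> u | u \<mu>. \<mu> \<ge> \<Lambda> \<and> normalized_eigenfunction G l M \<mu> u}" for \<Lambda> :: real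
  define m where "m \<Lambda> = Inf (masses \<Lambda>)" for \<Lambda>
  let ?\<alpha> = "\<lambda>e. measure lebesgue (\<omega> e)"
  define Q where "Q = 2 / Min (l ` arcs G)"
  have "\<exists>K. \<forall>k\<ge>K. \<forall>e\<in>arcs G. \<forall>u. normalized_eigenfunction G l M (k\<^sup>2) u \<longrightarrow>
      edge_intensity (l e) k (u e) \<in> {0..Q}"
    using eigenfunction_intensity_bounded[of M] by (simp only: eventually_at_top_linorder Q_def)
  then obtain K' where K': "\<forall>k\<ge>K'. \<forall>e\<in>arcs G. \<forall>u. normalized_eigenfunction G l M (k\<^sup>2) u \<longrightarrow>
      edge_intensity (l e) k (u e) \<in> {0..Q}" ..
  define K where "K = max K' 1"
  have qK: "edge_intensity (l e) k (u e) \<in> {0..Q}"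
    if "k \<ge> K" "e \<in> arcs G" "normalized_eigenfunction G l M (k\<^sup>2) u" for k e u
    using K' that unfolding K_def max.bounded_iff by blast
  have nonempty: "masses \<Lambda> \<noteq> {}" for \<Lambda>
  proof -
    obtain k u where k: "k \<ge> max 1 \<Lambda>" and u: "normalized_eigenfunction G l M (k\<^sup>2) u"
      by (rule normalized_eigenfunction_exists[where M = M and K = "max 1 \<Lambda>", OF M])
    have "k \<le> k\<^sup>2" using k by (intro self_le_power) auto
    then have "\<Lambda> \<le> k\<^sup>2" using k by simp
    then show ?thesis using u unfolding masses_def by blast
  qed
  have bdd: "bdd_below (masses \<Lambda>)" for \<Lambda>
    unfolding masses_def by (intro bdd_belowI[of _ 0]) (auto simp: L2_mass_nonneg)
  have mono: "m \<Lambda> \<le> m \<Lambda>'" if "\<Lambda> \<le> \<Lambda>'" for \<Lambda> \<Lambda>'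
    unfolding m_def
  proof (rule cInf_superset_mono[OF nonempty bdd])
    show "masses \<Lambda>' \<subseteq> masses \<Lambda>" unfolding masses_def using order_trans[OF that] by blast
  qed
  have m_le: "m \<Lambda> \<le> L2_mass G \<omega> u" if "\<mu> \<ge> \<Lambda>" "normalized_eigenfunction G l M \<mu> u" for \<Lambda> \<mu> u
    unfolding m_def using that by (intro cInf_lower bdd) (auto simp: masses_def)
  have m_le_limit: "m \<Lambda> \<le> edge_dot G ?\<alpha> q"
    if k: "filterlim k at_top sequentially" and u: "\<And>n. normalized_eigenfunction G l M ((k n)\<^sup>2) (u n)"
      and q: "\<And>e. e \<in> arcs G \<Longrightarrow> (\<lambda>n. edge_intensity (l e) (k n) (u n e)) \<longlonglongrightarrow> q e" for \<Lambda> k u q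
  proof (rule tendsto_lowerbound[OF mass_tendsto[OF \<omega> k u q]])
    have "\<forall>\<^sub>F n in sequentially. k n \<ge> max 1 \<Lambda>" using k unfolding filterlim_at_top by blast
    then show "\<forall>\<^sub>F n in sequentially. m \<Lambda> \<le> L2_mass G \<omega> (u n)"
    proof eventually_elim
      case (elim n)
      have "k n \<le> (k n)\<^sup>2" using elim by (intro self_le_power) auto
      then show ?case using elim by (intro m_le[OF _ u]) auto
    qed
  qed auto
  (* The summand K^2 keeps all chosen frequencies above K, where the intensities are bounded by Q. *)
  have "\<exists>\<mu> u. \<mu> \<ge> real n + 1 + K\<^sup>2 \<and> normalized_eigenfunction G l M \<mu> u
      \<and> L2_mass G \<omega> u < m (real n + 1 + K\<^sup>2) + 1 / (real n + 1)" for n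
  proof -
    have "Inf (masses (real n + 1 + K\<^sup>2)) < m (real n + 1 + K\<^sup>2) + 1 / (real n + 1)"
      unfolding m_def by simp
    from cInf_lessD[OF nonempty this] show ?thesis unfolding masses_def by blast
  qed
  then obtain \<mu> u where \<mu>: "\<And>n. \<mu> n \<ge> real n + 1 + K\<^sup>2"
    and u\<mu>: "\<And>n. normalized_eigenfunction G l M (\<mu> n) (u n)"
    and near: "\<And>n. L2_mass G \<omega> (u n) < m (real n + 1 + K\<^sup>2) + 1 / (real n + 1)"
    by metis
  define k where "k n = sqrt (\<mu> n)" for n
  have \<mu>0: "\<mu> n > 0" for n using \<mu>[of n] by (smt (verit) of_nat_0_le_iff zero_le_power2)
  have k0: "k n > 0" "(k n)\<^sup>2 = \<mu> n" for n using \<mu>0[of n] by (simp_all add: k_def)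
  have kK: "k n \<ge> K" for n
    unfolding k_def using \<mu>[of n] by (intro real_le_rsqrt) simp
  have k_lim: "filterlim k at_top sequentially"
  proof (rule filterlim_at_top_mono)
    show "filterlim (\<lambda>n. sqrt (real n)) at_top sequentially" by real_asymp
    show "\<forall>\<^sub>F n in sequentially. sqrt (real n) \<le> k n"
    proof (intro always_eventually allI)
      fix n
      show "sqrt (real n) \<le> k n"
        unfolding k_def using \<mu>[of n] zero_le_power2[of K] by (intro real_sqrt_le_mono) linarith
    qed
  qed
  have u: "normalized_eigenfunction G l M ((k n)\<^sup>2) (u n)" for n using u\<mu> k0 by simp
  have "\<exists>r q. strict_mono r \<and> (\<forall>e\<in>arcs G. (\<lambda>n. edge_intensity (l e) (k (r n)) (u (r n) e)) \<longlonglongrightarrow> q e)"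
    using finite_family_convergent_subsequence[OF finite_arcs, of "\<lambda>e n. edge_intensity (l e) (k n) (u n e)" 0 Q]
      qK[OF kK _ u] by blast
  then obtain r q where r: "strict_mono r"
    and q: "\<And>e. e \<in> arcs G \<Longrightarrow> (\<lambda>n. edge_intensity (l e) (k (r n)) (u (r n) e)) \<longlonglongrightarrow> q e" by blast
  have kr: "filterlim (\<lambda>n. k (r n)) at_top sequentially"
    using filterlim_compose[OF k_lim filterlim_subseq[OF r]] .
  define c where "c = (SUP \<Lambda>. m \<Lambda>)"
  have bdd_m: "bdd_above (range m)"
    using m_le_limit[OF kr u q] by (intro bdd_aboveI) auto
  have m_lim: "(m \<longlongrightarrow> c) at_top"
  proof (rule order_tendstoI)
    fix a assume "a < c"
    then obtain \<Lambda> where "a < m \<Lambda>" unfolding c_def using less_cSUP_iff[OF _ bdd_m] by auto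
    then show "\<forall>\<^sub>F x in at_top. a < m x"
      by (intro eventually_mono[OF eventually_ge_at_top[of \<Lambda>]]) (erule less_le_trans, rule mono)
  next
    fix a assume "c < a"
    moreover have "m x \<le> c" for x unfolding c_def using bdd_m by (intro cSUP_upper) auto
    ultimately show "\<forall>\<^sub>F x in at_top. m x < a" by (intro always_eventually allI) (rule le_less_trans)
  qed
  have C: "C_infty G l M \<omega> = c"
    using tendsto_Lim[OF trivial_limit_at_top_linorder m_lim]
    unfolding C_infty_def m_def masses_def by simp
  show "C_infty G l M \<omega> \<le> edge_dot G ?\<alpha> q'" if q': "q' \<in> attainable_set G l M" for q'
  proof -
    obtain u' k' where k': "filterlim k' at_top sequentially"
      and u': "\<And>n. normalized_eigenfunction G l M ((k' n)\<^sup>2) (u' n)"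
      and lim: "\<And>e. e \<in> arcs G \<Longrightarrow> (\<lambda>n. edge_intensity (l e) (k' n) (u' n e)) \<longlonglongrightarrow> q' e"
      using q' unfolding attainable_set_def by blast
    show ?thesis unfolding C c_def by (intro cSUP_least m_le_limit[OF k' u' lim]) auto
  qed
  define q0 where "q0 = restrict q (arcs G)"
  have q0: "(\<lambda>n. edge_intensity (l e) (k (r n)) (u (r n) e)) \<longlonglongrightarrow> q0 e" if "e \<in> arcs G" for e
    using q[OF that] that by (simp add: q0_def)
  have q0_nonneg: "q0 e \<ge> 0" if "e \<in> arcs G" for e
  proof (rule tendsto_lowerbound[OF q0[OF that]])
    show "\<forall>\<^sub>F n in sequentially. 0 \<le> edge_intensity (l e) (k (r n)) (u (r n) e)"
      using qK[OF kK that u] by (intro always_eventually allI) auto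
  qed simp
  have "q0 \<in> attainable_set G l M"
    unfolding attainable_set_def mem_Collect_eq
  proof
    show "q0 \<in> arcs G \<rightarrow>\<^sub>E {0..}" using q0_nonneg by (auto simp: q0_def)
    show "\<exists>u k. filterlim k at_top sequentially \<and> (\<forall>n. k n > 0 \<and> normalized_eigenfunction G l M ((k n)\<^sup>2) (u n)) \<and>
          (\<forall>e\<in>arcs G. (\<lambda>n. edge_intensity (l e) (k n) (u n e)) \<longlonglongrightarrow> q0 e)"
      using kr k0(1) u q0 by (intro exI[of _ "\<lambda>n. u (r n)"] exI[of _ "\<lambda>n. k (r n)"]) simp
  qed
  moreover have "C_infty G l M \<omega> = edge_dot G ?\<alpha> q0"
  proof -
    have "(\<lambda>n. L2_mass G \<omega> (u n)) \<longlonglongrightarrow> c"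
    proof (rule tendsto_sandwich)
      have fl: "filterlim (\<lambda>n. real n + 1 + K\<^sup>2) at_top sequentially" by real_asymp
      show "(\<lambda>n. m (real n + 1 + K\<^sup>2)) \<longlonglongrightarrow> c" by (rule filterlim_compose[OF m_lim fl])
      moreover have "(\<lambda>n. 1 / (real n + 1)) \<longlonglongrightarrow> 0" by real_asymp
      ultimately show "(\<lambda>n. m (real n + 1 + K\<^sup>2) + 1 / (real n + 1)) \<longlonglongrightarrow> c"
        using tendsto_add[where b = 0] by fastforce
      show "\<forall>\<^sub>F n in sequentially. m (real n + 1 + K\<^sup>2) \<le> L2_mass G \<omega> (u n)"
        by (intro always_eventually allI m_le[OF \<mu> u\<mu>])
      show "\<forall>\<^sub>F n in sequentially. L2_mass G \<omega> (u n) \<le> m (real n + 1 + K\<^sup>2) + 1 / (real n + 1)"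
        by (intro always_eventually allI less_imp_le near)
    qed
    from LIMSEQ_subseq_LIMSEQ[OF this r]
    have "(\<lambda>n. L2_mass G \<omega> (u (r n))) \<longlonglongrightarrow> c" by (simp add: o_def)
    then show ?thesis
      unfolding C using mass_tendsto[OF \<omega> kr u q0] by (rule LIMSEQ_unique)
  qed
  ultimately show "\<exists>q\<in>attainable_set G l M. C_infty G l M \<omega> = edge_dot G ?\<alpha> q" by blast
qed

end

theorem theorem2p6:
  fixes G :: "('v, 'e) pre_digraph"
    and l :: "'e \<Rightarrow> real"
    and M :: "'v \<Rightarrow> (complex \<times> complex) set"
    and \<omega> :: "'e \<Rightarrow> real set"
    and \<alpha> :: "'e \<Rightarrow> real"
  assumes "fin_digraph G" and "arcs G \<noteq> {}"
    and "\<And>e. e \<in> arcs G \<Longrightarrow> l e > 0"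
    and "\<And>v. v \<in> exterior_verts G \<Longrightarrow> selfadjoint_condition (M v)"
    and "measurable_subset G l \<omega>"
    and "\<And>e. e \<in> arcs G \<Longrightarrow> \<alpha> e = measure lebesgue (\<omega> e)"
  shows "(\<exists>q\<in>attainable_set G l M. C_infty G l M \<omega> = edge_dot G \<alpha> q) \<and>
         (\<forall>q\<in>attainable_set G l M. C_infty G l M \<omega> \<le> edge_dot G \<alpha> q) \<and>
         (\<forall>\<omega>'. measurable_subset G l \<omega>' \<and>
               (\<forall>e\<in>arcs G. measure lebesgue (\<omega>' e) = measure lebesgue (\<omega> e)) \<longrightarrow>
               C_infty G l M \<omega>' = C_infty G l M \<omega>)"
proof -
  interpret metric_graph G l
    using assms(1-3) by (intro metric_graph.intro metric_graph_axioms.intro)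
  have dot: "edge_dot G \<alpha> q = edge_dot G (\<lambda>e. measure lebesgue (\<omega>' e)) q"
    if "\<forall>e\<in>arcs G. measure lebesgue (\<omega>' e) = measure lebesgue (\<omega> e)" for \<omega>' q
    unfolding edge_dot_def using that assms(6) by (intro sum.cong refl) simp
  have attained: "\<exists>q\<in>attainable_set G l M. C_infty G l M \<omega>' = edge_dot G \<alpha> q"
    and minimal: "\<forall>q\<in>attainable_set G l M. C_infty G l M \<omega>' \<le> edge_dot G \<alpha> q"
    if \<omega>': "measurable_subset G l \<omega>'" "\<forall>e\<in>arcs G. measure lebesgue (\<omega>' e) = measure lebesgue (\<omega> e)" for \<omega>'
    using localization_constant_attained[where M = M, OF \<omega>'(1) assms(4)] unfolding dot[OF \<omega>'(2)] by blast+
  have "C_infty G l M \<omega>' = C_infty G l M \<omega>"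
    if \<omega>': "measurable_subset G l \<omega>'" "\<forall>e\<in>arcs G. measure lebesgue (\<omega>' e) = measure lebesgue (\<omega> e)" for \<omega>'
    using attained[OF \<omega>'] minimal[OF \<omega>'] attained[OF assms(5)] minimal[OF assms(5)]
    by (metis order_antisym)
  then show ?thesis using attained[OF assms(5)] minimal[OF assms(5)] by blast
qed

end
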